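(* Let $t$ be an odd square-free positive integer, let $q$ be an odd prime, let $r$ be a natural number, and put $m=q^r$. Then the class number of the imaginary quadratic field $\mathbb{Q}(\sqrt{1-2m^t})$ is divisible by $t$. Moreover, for a fixed $t$, the collection of fields $\mathbb{Q}(\sqrt{1-2m^t})$, where $m$ ranges over all powers $q^r$ of odd primes $q$ with $r\ge 1$, is an infinite family of imaginary quadratic fields.
   Context: The class number of a number field is the order of its ideal class group. *)

theory Defs
  imports
    Complex_Main
    "HOL-Algebra.Algebra"
    "HOL-Algebra.Algebraic_Closure_Type"
    "HOL-Computational_Algebra.Squarefree"
begin

text \<open>Number fields are represented as subfields of the complex numbers.\<close>

abbreviation complex_field :: "complex ring" where
  "complex_field \<equiv> ring_of_type_algebra"

definition rat_adjoin_sqrt :: "int \<Rightarrow> complex set" where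
  "rat_adjoin_sqrt d = generate_field complex_field {csqrt (of_int d)}"

definition imaginary_quadratic_field :: "complex set \<Rightarrow> bool" where
  "imaginary_quadratic_field K \<longleftrightarrow>
     subfield K complex_field \<and> ring.dimension complex_field 2 \<rat> K \<and> \<not> K \<subseteq> \<real>"

definition ring_of_integers :: "complex set \<Rightarrow> complex ring" where
  "ring_of_integers K = complex_field\<lparr>carrier := {x \<in> K. algebraic_int x}\<rparr>"

text \<open>The zero module is not counted as a fractional ideal, so that fractional ideals
  of a number field form a group under multiplication.\<close>

definition fractional_ideal :: "complex set \<Rightarrow> complex set \<Rightarrow> bool" where
  "fractional_ideal K I \<longleftrightarrow>
     I \<subseteq> K \<and> I \<noteq> {0} \<and>
     (\<exists>d \<in> carrier (ring_of_integers K). d \<noteq> 0 \<and> ideal ((*) d ` I) (ring_of_integers K))"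

text \<open>The library's \<open>ideal_prod\<close> is the set of nonempty finite sums of products of elements, a
  description that is equally valid for fractional ideals.\<close>

definition fractional_ideal_group :: "complex set \<Rightarrow> complex set monoid" where
  "fractional_ideal_group K =
     \<lparr>carrier = {I. fractional_ideal K I},
      monoid.mult = ideal_prod complex_field,
      one = carrier (ring_of_integers K)\<rparr>"

definition principal_fractional_ideals :: "complex set \<Rightarrow> complex set set" where
  "principal_fractional_ideals K =
     {(*) a ` carrier (ring_of_integers K) | a. a \<in> K \<and> a \<noteq> 0}"

definition ideal_class_group :: "complex set \<Rightarrow> complex set set monoid" where
  "ideal_class_group K = fractional_ideal_group K Mod principal_fractional_ideals K"

definition class_number :: "complex set \<Rightarrow> nat" where
  "class_number K = Coset.order (ideal_class_group K)"

end

theory Submission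
  imports Defs
begin

text \<open>Write \<open>1 - 2 m\<^sup>t = s\<^sup>2 D\<close> with \<open>D\<close> square-free. As \<open>m\<close> is odd, \<open>D \<equiv> 3 (mod 4)\<close>, so the ring of integers
  is \<open>\<int>[\<surd>D]\<close>. The element \<open>\<beta> = 1 - m\<^sup>t + s\<surd>D = (1 + s\<surd>D)\<^sup>2 / 2\<close> has norm \<open>m\<^bsup>2t\<^esup>\<close> and is coprime to its
  conjugate, hence \<open>(\<beta>) = J\<^sup>t\<close> with \<open>J = (m\<^sup>2, \<beta>)\<close>. The class of \<open>J\<close> has order exactly \<open>t\<close>: otherwise
  \<open>\<beta> = \<gamma>\<^sup>k\<close> for some odd \<open>k > 1\<close> (units are fourth roots of unity, hence \<open>k\<close>-th powers), and
  \<open>\<delta> = (1 + s\<surd>D) / \<gamma>\<^bsup>(k-1)/2\<^esup>\<close> is an integer with \<open>\<delta>\<^sup>2 = 2 \<gamma>\<close> and \<open>\<delta>\<^sup>k = 2\<^bsup>(k-1)/2\<^esup> (1 + s\<surd>D)\<close>. Comparing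
  real parts forces \<open>\<delta> = \<plusminus>1 + v\<surd>D\<close> with \<open>1 - v\<^sup>2 D = 2 n\<close>, \<open>n\<close> odd, and a 2-adic estimate shows that the
  real part of \<open>(1 + \<surd>(1 - 2 n))\<^sup>k\<close> is \<open>\<plusminus>2\<^bsup>(k-1)/2\<^esup>\<close> only for \<open>n = 1\<close>.

  For \<open>m = 3\<^sup>r\<close> with \<open>r\<close> odd the same applies to \<open>3\<close> and the exponent \<open>r t\<close>. If only finitely many fields occurred,
  then one field would contain ideals \<open>(9, z)\<close> whose classes have infinitely many different orders \<open>r t\<close>,
  although there are only finitely many ideals of this shape.\<close>

subsection \<open>Real parts of powers of \<open>1 + S\<close> with \<open>S\<^sup>2 \<equiv> 3 (mod 4)\<close>\<close>

text \<open>When \<open>S ^ 2\<close> is an integer this is the order \<int>[S]. The generator stays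
  a parameter because both \<open>om\<close> and integer multiples of \<open>om\<close> are used for
  it.\<close>

definition zring :: "complex \<Rightarrow> complex set" where
  "zring S = {of_int a + of_int b * S | a b :: int. True}"

lemma zring_of_int [simp, intro]: "of_int a \<in> zring S"
  unfolding zring_def by (rule CollectI, rule exI[of _ a], rule exI[of _ 0]) simp

lemma zring_numeral [simp, intro]: "numeral n \<in> zring S" "0 \<in> zring S" "1 \<in> zring S" "of_nat k \<in> zring S"
  using zring_of_int[of "numeral n" S] zring_of_int[of 0 S] zring_of_int[of 1 S] zring_of_int[of "int k" S]
  by simp_all

lemma zring_gen [simp, intro]: "S \<in> zring S"
  unfolding zring_def by (rule CollectI, rule exI[of _ 0], rule exI[of _ 1]) simp

lemma zring_add [intro]: "x \<in> zring S \<Longrightarrow> y \<in> zring S \<Longrightarrow> x + y \<in> zring S"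
  unfolding zring_def
  by (clarify, rename_tac a c b d, rule_tac x = "a + c" in exI, rule_tac x = "b + d" in exI)
     (simp add: algebra_simps)

lemma zring_uminus [intro]: "x \<in> zring S \<Longrightarrow> - x \<in> zring S"
  unfolding zring_def
  by (clarify, rename_tac a b, rule_tac x = "- a" in exI, rule_tac x = "- b" in exI)
     (simp add: algebra_simps)

lemma zring_diff [intro]: "x \<in> zring S \<Longrightarrow> y \<in> zring S \<Longrightarrow> x - y \<in> zring S"
  using zring_add[OF _ zring_uminus, of x S y] by simp

lemma zring_sum: "(\<And>i. i \<in> A \<Longrightarrow> f i \<in> zring S) \<Longrightarrow> sum f A \<in> zring S"
  by (induction A rule: infinite_finite_induct) auto

lemma zring_mult [intro]:
  assumes "S ^ 2 = of_int D" "x \<in> zring S" "y \<in> zring S"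
  shows "x * y \<in> zring S"
proof -
  obtain a b c d :: int where e: "x = of_int a + of_int b * S" "y = of_int c + of_int d * S"
    using assms(2,3) unfolding zring_def by blast
  have "x * y = of_int (a * c + b * d * D) + of_int (a * d + b * c) * S"
    unfolding e of_int_add of_int_mult assms(1)[symmetric] by (simp add: algebra_simps power2_eq_square)
  then show ?thesis unfolding zring_def by blast
qed

lemma zring_power [intro]:
  assumes "S ^ 2 = of_int D" "x \<in> zring S"
  shows "x ^ n \<in> zring S"
  by (induction n) (auto intro: zring_mult[OF assms(1)] assms(2))

lemma Re_zring: "Re S = 0 \<Longrightarrow> x \<in> zring S \<Longrightarrow> Re x \<in> \<int>"
  unfolding zring_def by auto

section \<open>Congruences for powers in \<int>[S]\<close>

text \<open>Powers of an element congruent to 1 modulo \<open>x\<close> stay so. This crude form is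
  enough for exponents 3 modulo 4, once with modulus \<open>4 * f * x\<close> and once with modulus
  \<open>S\<close>.\<close>

lemma pow_one_plus_mult:
  assumes S: "S ^ 2 = of_int D" and x: "x \<in> zring S"
  shows "\<exists>t \<in> zring S. (1 + x) ^ l = 1 + x * t"
proof (induction l)
  case 0 show ?case by (rule bexI[of _ 0]) auto
next
  case (Suc l)
  then obtain t where t: "t \<in> zring S" "(1 + x) ^ l = 1 + x * t" by blast
  show ?case
  proof (rule bexI)
    show "(1 + x) ^ Suc l = 1 + x * (t + 1 + x * t)" using t(2) by (simp add: algebra_simps)
    show "t + 1 + x * t \<in> zring S" using t(1) x by (intro zring_add zring_mult[OF S]) auto
  qed
qed

text \<open>For \<open>S\<^sup>2 = 4 f - 1\<close> the relevant \<open>x\<close> satisfies \<open>Re ((1 + S) * x) = - 5 f\<close>, so the error term below is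
  2-adically smaller than the linear term.\<close>

lemma pow_two_power_expansion:
  assumes S: "S ^ 2 = of_int D" and x: "x \<in> zring S"
  shows "\<exists>t \<in> zring S. (1 + 4 * of_int f * x) ^ (2 ^ a) =
           1 + 4 * of_int f * 2 ^ a * x + 8 * of_int f ^ 2 * 2 ^ a * t"
proof (induction a)
  case 0 show ?case by (rule bexI[of _ 0]) auto
next
  case (Suc a)
  then obtain t where t: "t \<in> zring S"
    "(1 + 4 * of_int f * x) ^ (2 ^ a) = 1 + 4 * of_int f * 2 ^ a * x + 8 * of_int f ^ 2 * 2 ^ a * t"
    by blast
  have p: "2 ^ n = (of_int (2 ^ n) :: complex)" for n by simp
  show ?case
  proof (rule bexI)
    show "(1 + 4 * of_int f * x) ^ (2 ^ Suc a) = 1 + 4 * of_int f * 2 ^ Suc a * x +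
       8 * of_int f ^ 2 * 2 ^ Suc a * (t + 2 ^ a * x ^ 2 + 4 * of_int f * 2 ^ a * x * t
         + 4 * of_int f ^ 2 * 2 ^ a * t ^ 2)"
      unfolding power_Suc2 power_mult t(2) by (simp add: algebra_simps power2_eq_square)
    show "t + 2 ^ a * x ^ 2 + 4 * of_int f * 2 ^ a * x * t + 4 * of_int f ^ 2 * 2 ^ a * t ^ 2 \<in> zring S"
      using t(1) x by (intro zring_add zring_mult[OF S] zring_power[OF S]) (auto simp: p)
  qed
qed

text \<open>Multiplying \<open>b\<close> copies of the expansion for \<open>2 ^ a\<close> adds up
  the linear terms, while products of two linear terms carry \<open>16 * f ^ 2 * 2 ^ a\<close> and
  go into the error. So \<open>b\<close> enters only linearly, and for odd \<open>b\<close> the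
  linear coefficient keeps its 2-adic size.\<close>

lemma pow_odd_expansion:
  assumes S: "S ^ 2 = of_int D" and x: "x \<in> zring S"
  shows "\<exists>t \<in> zring S. (1 + 4 * of_int f * x) ^ (2 ^ a * b) =
           1 + 4 * of_int f * 2 ^ a * of_nat b * x + 8 * of_int f ^ 2 * 2 ^ a * t"
proof (induction b)
  case 0 show ?case by (rule bexI[of _ 0]) auto
next
  case (Suc b)
  have p: "2 ^ n = (of_int (2 ^ n) :: complex)" for n by simp
  obtain t where t: "t \<in> zring S"
    "(1 + 4 * of_int f * x) ^ (2 ^ a) = 1 + 4 * of_int f * 2 ^ a * x + 8 * of_int f ^ 2 * 2 ^ a * t"
    using pow_two_power_expansion[OF assms] by blast
  obtain t' where t': "t' \<in> zring S"
    "(1 + 4 * of_int f * x) ^ (2 ^ a * b) = 1 + 4 * of_int f * 2 ^ a * of_nat b * x + 8 * of_int f ^ 2 * 2 ^ a * t'"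
    using Suc by blast
  define Y where "Y = 4 * of_int f * 2 ^ a * of_nat b * x + 8 * of_int f ^ 2 * 2 ^ a * t'"
  define Z where "Z = t + t' + 2 * 2 ^ a * of_nat b * x ^ 2 + 4 * of_int f * 2 ^ a * x * t'
     + t * Y"
  show ?case
  proof (rule bexI)
    have "(1 + 4 * of_int f * x) ^ (2 ^ a * Suc b) =
        (1 + 4 * of_int f * x) ^ (2 ^ a) * (1 + 4 * of_int f * x) ^ (2 ^ a * b)"
      by (simp add: power_add)
    also have "\<dots> = 1 + 4 * of_int f * 2 ^ a * of_nat (Suc b) * x + 8 * of_int f ^ 2 * 2 ^ a * Z"
      unfolding t(2) t'(2) Z_def Y_def by (simp add: algebra_simps power2_eq_square)
    finally show "(1 + 4 * of_int f * x) ^ (2 ^ a * Suc b) = 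
        1 + 4 * of_int f * 2 ^ a * of_nat (Suc b) * x + 8 * of_int f ^ 2 * 2 ^ a * Z" .
    show "Z \<in> zring S" unfolding Z_def Y_def
      using t(1) t'(1) x by (intro zring_add zring_mult[OF S] zring_power[OF S]) (auto simp: p)
  qed
qed

lemma Re_of_real_mult: "Re (of_real c * z) = c * Re z"
  by simp

text \<open>Square \<open>(1 + S) ^ 2 = 4 * f + 2 * S\<close>. For \<open>f = 0\<close> this is the
  identity \<open>(1 + \<i>) ^ 4 = - 4\<close>, and in general it is a perturbation of it modulo
  \<open>4 * f\<close>.\<close>

lemma one_plus_pow_4:
  fixes S :: complex
  assumes S: "S ^ 2 = of_int (4 * f - 1)"
  shows "(1 + S) ^ 4 = - 4 * (1 + 4 * of_int f * (- (of_int f + 1 + S)))"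
proof -
  have SS: "S * S = 4 * of_int f - 1" using S(1) by (simp add: power2_eq_square)
  have "(1 + S) ^ 4 = (1 + 2 * S + S * S) * (1 + 2 * S + S * S)"
    by (simp add: power4_eq_xxxx algebra_simps)
  then show ?thesis
    unfolding SS by (simp add: algebra_simps SS) (simp add: SS flip: mult.assoc)
qed

text \<open>The real part is \<open>(- 4) ^ l\<close> times
  \<open>1 + 4 * f ^ 2 * 2 ^ a * (2 * z - 5 * b)\<close>, where \<open>b\<close> is the odd part of
  \<open>l\<close>. The last bracket is odd, hence nonzero, so the cofactor is not 1; being 1 modulo
  4 it is not \<open>- 1\<close> either.\<close>

lemma Re_pow_1_mod_4:
  assumes S: "S ^ 2 = of_int (4 * f - 1)" "Re S = 0" and f: "f \<noteq> 0" and l: "l > 0"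
  shows "\<bar>Re ((1 + S) ^ (4 * l + 1))\<bar> \<noteq> 4 ^ l"
proof -
  \<comment> \<open>Chosen so that \<open>(1 + S) ^ 4 = - 4 * (1 + 4 * f * x)\<close>, see
    \<open>one_plus_pow_4\<close>.\<close>
  define x where "x = - (of_int f + 1 + S)"
  have x: "x \<in> zring S" unfolding x_def by (intro zring_add zring_uminus) auto
  have SS: "S * S = 4 * of_int f - 1" using S(1) by (simp add: power2_eq_square)
  have p: "2 ^ n = (of_int (2 ^ n) :: complex)" for n by simp
  have p': "2 ^ n = (of_real (2 ^ n) :: complex)" for n by simp
  obtain a b where ab: "l = 2 ^ a * b" "odd b"
    using l by (metis multiplicity_decompose' not_is_unit_0 odd_one gr_implies_not0)
  obtain t where t: "t \<in> zring S" "(1 + 4 * of_int f * x) ^ l =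
           1 + 4 * of_int f * 2 ^ a * of_nat b * x + 8 * of_int f ^ 2 * 2 ^ a * t"
    using pow_odd_expansion[OF S(1) x] ab(1) by blast
  have sx: "Re ((1 + S) * x) = - 5 * of_int f"
  proof -
    have "(1 + S) * x = - (5 * of_int f) - (of_int f + 2) * S"
      unfolding x_def using SS by (simp add: algebra_simps)
    then show ?thesis using S(2) by simp
  qed
  have "(1 + S) * t \<in> zring S" using t(1) by (intro zring_mult[OF S(1)] zring_add) auto
  then obtain z :: int where z: "Re ((1 + S) * t) = of_int z"
    using Re_zring[OF S(2)] by (metis Ints_cases)
  have "(1 + S) ^ (4 * l + 1) = (1 + S) * ((1 + S) ^ 4) ^ l" by (simp add: power_mult)
  also have "\<dots> = of_real ((- 4) ^ l) * ((1 + S) * (1 + 4 * of_int f * x) ^ l)"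
    unfolding one_plus_pow_4[OF S(1)] x_def power_mult_distrib by simp
  also have "(1 + S) * (1 + 4 * of_int f * x) ^ l
     = (1 + S) + of_real (4 * of_int f * 2 ^ a * of_nat b) * ((1 + S) * x)
        + of_real (8 * of_int f ^ 2 * 2 ^ a) * ((1 + S) * t)"
    unfolding t(2) by (simp add: algebra_simps)
  finally have "Re ((1 + S) ^ (4 * l + 1)) =
     (- 4) ^ l * (1 + 4 * of_int f * 2 ^ a * of_nat b * (- 5 * of_int f)
       + 8 * of_int f ^ 2 * 2 ^ a * of_int z)"
    using sx z S(2) by (simp only: Re_of_real_mult plus_complex.sel) simp
  also have "\<dots> = (- 4) ^ l * of_int (1 + 4 * (f ^ 2 * 2 ^ a * (2 * z - 5 * int b)))"
    by (simp add: algebra_simps power2_eq_square)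
  finally have R: "Re ((1 + S) ^ (4 * l + 1)) = (- 4) ^ l * of_int (1 + 4 * (f ^ 2 * 2 ^ a * (2 * z - 5 * int b)))" .
  have odd: "2 * z - 5 * int b \<noteq> 0" using ab(2) by presburger
  have "1 + 4 * (f ^ 2 * 2 ^ a * (2 * z - 5 * int b)) \<noteq> 1" using odd f by simp
  moreover have "1 + 4 * (f ^ 2 * 2 ^ a * (2 * z - 5 * int b)) \<noteq> - 1" by presburger
  ultimately have n: "\<bar>of_int (1 + 4 * (f ^ 2 * 2 ^ a * (2 * z - 5 * int b))) :: real\<bar> \<noteq> 1"
    by linarith
  show ?thesis unfolding R abs_mult power_abs using n by simp
qed

text \<open>Here the congruence modulo \<open>4 f\<close> leaves one case open, \<open>f = - 1\<close>, that is \<open>S\<^sup>2 = - 5\<close>, which is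
  excluded modulo 5.\<close>

lemma Re_pow_3_mod_4:
  assumes S: "S ^ 2 = of_int (4 * f - 1)" "Re S = 0" and f: "f < 0"
  shows "\<bar>Re ((1 + S) ^ (4 * l + 3))\<bar> \<noteq> 2 * 4 ^ l"
proof -
  define x where "x = - (of_int f + 1 + S)"
  have x: "x \<in> zring S" unfolding x_def by (intro zring_add zring_uminus) auto
  have x': "4 * of_int f * x \<in> zring S"
    using x by (intro zring_mult[OF S(1)]) auto
  have SS: "S * S = 4 * of_int f - 1" using S(1) by (simp add: power2_eq_square)
  obtain t where t: "t \<in> zring S" "(1 + 4 * of_int f * x) ^ l = 1 + 4 * of_int f * x * t"
    using pow_one_plus_mult[OF S(1) x'] by blast
  \<comment> \<open>This is half of \<open>(1 + S) ^ 3\<close>; its real part is \<open>- 1\<close>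
    modulo \<open>f\<close>, which fixes the real part of the whole power up to multiples of
    \<open>f\<close>.\<close>
  define y where "y = (6 * of_int f - 1) + (2 * of_int f + 1) * S"
  have y: "y \<in> zring S" unfolding y_def by (intro zring_add zring_diff zring_mult[OF S(1)]) auto
  have three: "(1 + S) ^ 3 = 2 * y"
  proof -
    have "(1 + S) ^ 3 = 1 + 3 * S + 3 * (S * S) + S * S * S"
      by (simp add: power3_eq_cube algebra_simps)
    then show ?thesis unfolding SS y_def by (simp add: algebra_simps)
  qed
  have "y * (x * t) \<in> zring S" using t(1) x y by (intro zring_mult[OF S(1)]) auto
  then obtain z :: int where z: "Re (y * (x * t)) = of_int z"
    using Re_zring[OF S(2)] by (metis Ints_cases)
  have ry: "Re y = 6 * of_int f - 1" unfolding y_def using S(2) by simp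
  have "(1 + S) ^ (4 * l + 3) = (1 + S) ^ 3 * ((1 + S) ^ 4) ^ l"
    unfolding power_mult[symmetric] power_add[symmetric] by (simp add: add.commute)
  also have "\<dots> = of_real (2 * (- 4) ^ l) * (y * (1 + 4 * of_int f * x) ^ l)"
    unfolding one_plus_pow_4[OF S(1)] three power_mult_distrib x_def by simp
  also have "y * (1 + 4 * of_int f * x) ^ l = y + of_real (4 * of_int f) * (y * (x * t))"
    unfolding t(2) by (simp add: algebra_simps)
  finally have "Re ((1 + S) ^ (4 * l + 3)) = 2 * (- 4) ^ l * (6 * of_int f - 1 + 4 * of_int f * of_int z)"
    using z ry by (simp only: Re_of_real_mult plus_complex.sel)
  also have "\<dots> = 2 * (- 4) ^ l * of_int (f * (6 + 4 * z) - 1)"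
    by (simp add: algebra_simps)
  finally have R: "Re ((1 + S) ^ (4 * l + 3)) = 2 * (- 4) ^ l * of_int (f * (6 + 4 * z) - 1)" .
  have a: "f * (6 + 4 * z) - 1 \<noteq> - 1" using f by (auto, presburger)
  have b: "f * (6 + 4 * z) - 1 \<noteq> 1"
  proof
    assume h: "f * (6 + 4 * z) - 1 = 1"
    then have "f * (3 + 2 * z) = 1" by (simp add: algebra_simps)
    then have "f = - 1" using f by (auto simp: zmult_eq_1_iff)
    then have S5: "S ^ 2 = of_int (- 5)" using S(1) by simp
    \<comment> \<open>Modulo \<open>S\<close> the power is 1, so its real part is 1 modulo 5,
      whereas \<open>h\<close> makes it \<open>2 * (- 4) ^ l\<close>, which is 2 modulo 5.\<close>
    obtain s where s: "s \<in> zring S" "(1 + S) ^ (4 * l + 3) = 1 + S * s"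
      using pow_one_plus_mult[OF S(1), of S] by blast
    obtain c d :: int where "s = of_int c + of_int d * S" using s(1) unfolding zring_def by blast
    then have "S * s = of_int c * S + of_int d * S ^ 2" by (simp add: algebra_simps power2_eq_square)
    then have "Re ((1 + S) ^ (4 * l + 3)) = of_int (1 - 5 * d)"
      unfolding s(2) S5 using S(2) by simp
    then have "of_int (1 - 5 * d) = (of_int (2 * (- 4) ^ l) :: real)"
      unfolding R h by simp
    then have e: "1 - 5 * d = 2 * (- 4) ^ l" by linarith
    have "(- 4 :: int) ^ l mod 5 = 1" using power_mod[of "- 4 :: int" 5 l] by simp
    then show False using e by presburger
  qed
  from a b have n: "\<bar>of_int (f * (6 + 4 * z) - 1) :: real\<bar> \<noteq> 1"
    by linarith
  show ?thesis unfolding R abs_mult power_abs using n by simp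
qed

text \<open>The value \<open>f = 0\<close>, that is \<open>S = \<plusminus>\<i>\<close>, is a true
  exception: every odd power of \<open>1 + \<i>\<close> has real part \<open>2 ^ (k div 2)\<close>
  up to sign. The lemma says that no negative \<open>f\<close> behaves like this.\<close>

lemma Re_odd_power_neq:
  assumes S: "S ^ 2 = of_int (4 * f - 1)" "Re S = 0" and f: "f < 0" and k: "odd k" "k > 1"
  shows "\<bar>Re ((1 + S) ^ k)\<bar> \<noteq> 2 ^ (k div 2)"
proof -
  consider l where "k = 4 * l + 1" "l > 0" | l where "k = 4 * l + 3"
  proof -
    have "k = 4 * (k div 4) + 1 \<and> k div 4 > 0 \<or> k = 4 * (k div 4) + 3" using k by presburger
    then show ?thesis using that by blast
  qed
  then show ?thesis
  proof cases
    case 1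
    then have "2 ^ (k div 2) = (4 :: real) ^ l" by (simp add: power_mult)
    then show ?thesis using Re_pow_1_mod_4[OF S _ 1(2)] f 1(1) by simp
  next
    case 2
    then have "k div 2 = 2 * l + 1" by simp
    then have "2 ^ (k div 2) = 2 * (4 :: real) ^ l" by (simp add: power_mult)
    then show ?thesis using Re_pow_3_mod_4[OF S f, of l] 2 by simp
  qed
qed

subsection \<open>Imaginary quadratic fields\<close>

lemma complex_field_simps [simp]:
  "carrier complex_field = UNIV" "x \<otimes>\<^bsub>complex_field\<^esub> y = x * y" "\<one>\<^bsub>complex_field\<^esub> = 1"
  "\<zero>\<^bsub>complex_field\<^esub> = 0" "x \<oplus>\<^bsub>complex_field\<^esub> y = x + y"
  by (simp_all add: ring_of_type_algebra_def)

interpretation complex_field: cring complex_field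
  by (rule cring_from_type_algebra)

lemma complex_field_a_inv [simp]: "\<ominus>\<^bsub>complex_field\<^esub> x = - x"
  using complex_field.minus_equality[of "- x" x] by simp

lemma complex_field_m_inv [simp]: "x \<noteq> 0 \<Longrightarrow> inv\<^bsub>complex_field\<^esub> x = inverse x"
  using complex_field.comm_inv_char[of x "inverse x"] by simp

lemma Rats_real_complex:
  assumes "(x :: complex) \<in> \<rat>"
  shows "x = of_real (Re x)" "Re x \<in> \<rat>"
proof -
  obtain a b where "x = of_int a / of_int b" using assms by (rule Rats_cases')
  then have "x = of_real (of_int a / of_int b)" by simp
  then show "x = of_real (Re x)" "Re x \<in> \<rat>" by simp_all
qed

lemma Rats_generate_field: "x \<in> \<rat> \<Longrightarrow> x \<in> generate_field complex_field H"
proof -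
  let ?G = "generate_field complex_field H"
  have one: "1 \<in> ?G" using generate_field.one[of complex_field H] by simp
  have neg: "x \<in> ?G \<Longrightarrow> - x \<in> ?G" for x using generate_field.a_inv[of x complex_field H] by simp
  have add: "x \<in> ?G \<Longrightarrow> y \<in> ?G \<Longrightarrow> x + y \<in> ?G" for x y
    using generate_field.eng_add[of x complex_field H y] by simp
  have nat: "of_nat n \<in> ?G" for n
    by (induction n) (use add[OF one neg[OF one]] one add in auto)
  have int: "of_int n \<in> ?G" for n
    by (cases n rule: int_cases2) (use nat neg in auto)
  assume "x \<in> \<rat>"
  then obtain a b :: int where ab: "b > 0" "x = of_int a / of_int b"
    by (metis Rats_cases')
  have "inverse (of_int b) \<in> ?G" using generate_field.m_inv[OF int[of b]] ab(1) by simp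
  from generate_field.eng_mult[OF int[of a] this] show ?thesis
    by (simp add: ab(2) divide_inverse)
qed

section \<open>The field of a negative integer in coordinates\<close>

text \<open>Only the sign of \<open>D\<close> is fixed, so that the locale covers both
  \<open>1 - 2 * m ^ t\<close> itself and its square-free part.\<close>

locale imaginary_sqrt =
  fixes D :: int
  assumes neg: "D < 0"
begin

definition om :: complex where "om = csqrt (of_int D)"

definition K :: "complex set" where "K = {x + y * om | x y. x \<in> \<rat> \<and> y \<in> \<rat>}"

lemma om_square: "om ^ 2 = of_int D"
  by (simp add: om_def)

lemma om_alt: "om = \<i> * of_real (sqrt \<bar>of_int D\<bar>)"
  using neg by (simp add: om_def)

lemma Re_om [simp]: "Re om = 0" and Im_om: "Im om > 0" and cnj_om [simp]: "cnj om = - om"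
  and om_nonzero [simp]: "om \<noteq> 0"
  using neg by (simp_all add: om_alt)

lemma Re_Im_K:
  assumes "x \<in> \<rat>" "y \<in> \<rat>"
  shows "Re (x + y * om) = Re x" "Im (x + y * om) = Re y * Im om"
proof -
  obtain a b :: real where ab: "x = of_real a" "y = of_real b"
    using assms Rats_real_complex by metis
  show "Re (x + y * om) = Re x" "Im (x + y * om) = Re y * Im om"
    unfolding ab by simp_all
qed

lemma K_I: "z = x + y * om \<Longrightarrow> x \<in> \<rat> \<Longrightarrow> y \<in> \<rat> \<Longrightarrow> z \<in> K"
  unfolding K_def by blast

lemma K_rat: "x \<in> \<rat> \<Longrightarrow> x \<in> K"
  unfolding K_def by (rule CollectI, rule exI[of _ x], rule exI[of _ 0]) simp

lemma K_om: "om \<in> K"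
  unfolding K_def by (rule CollectI, rule exI[of _ 0], rule exI[of _ 1]) simp

lemma K_add [intro]: "x \<in> K \<Longrightarrow> y \<in> K \<Longrightarrow> x + y \<in> K"
  unfolding K_def
  by (clarify, rename_tac a c b d, rule_tac x = "a + c" in exI, rule_tac x = "b + d" in exI)
     (simp add: algebra_simps)

lemma K_mult [intro]:
  assumes "x \<in> K" "y \<in> K" shows "x * y \<in> K"
proof -
  obtain a b c d where e: "x = a + b * om" "y = c + d * om" "a \<in> \<rat>" "b \<in> \<rat>" "c \<in> \<rat>" "d \<in> \<rat>"
    using assms unfolding K_def by blast
  have "x * y = (a * c + b * d * of_int D) + (a * d + b * c) * om"
    unfolding e of_int_add of_int_mult om_square[symmetric] by (simp add: algebra_simps power2_eq_square)
  then show ?thesis by (rule K_I) (use e(3-6) in auto)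
qed

lemma K_uminus [intro]: "x \<in> K \<Longrightarrow> - x \<in> K"
  using K_mult[OF K_rat[of "- 1"], of x] by simp

lemma cnj_K_form:
  assumes "x \<in> \<rat>" "y \<in> \<rat>"
  shows "cnj (x + y * om) = x - y * om"
proof -
  have "cnj x = x" "cnj y = y"
    using assms Rats_real_complex(1) by (metis complex_cnj_complex_of_real)+
  then show ?thesis by simp
qed

lemma K_cnj [intro]:
  assumes "x \<in> K" shows "cnj x \<in> K"
proof -
  obtain a b where e: "x = a + b * om" "a \<in> \<rat>" "b \<in> \<rat>" using assms unfolding K_def by blast
  have "cnj x = a + (- b) * om" unfolding e cnj_K_form[OF e(2,3)] by simp
  then show ?thesis by (rule K_I) (use e(2,3) in auto)
qed

lemma K_norm:
  assumes "x \<in> K" shows "x * cnj x \<in> \<rat>"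
proof -
  obtain a b where e: "x = a + b * om" "a \<in> \<rat>" "b \<in> \<rat>" using assms unfolding K_def by blast
  have "x * cnj x = a * a - b * b * of_int D"
    unfolding om_square[symmetric] e(1) cnj_K_form[OF e(2,3)] by (simp add: algebra_simps power2_eq_square)
  then show ?thesis using e by simp
qed

lemma K_inverse [intro]:
  assumes "x \<in> K" shows "inverse x \<in> K"
proof (cases "x = 0")
  case False
  then have "inverse x = cnj x * inverse (x * cnj x)" by (simp add: field_simps)
  then show ?thesis using assms K_norm by (metis K_mult K_cnj K_rat Rats_inverse)
qed (simp add: K_rat)

lemma K_divide [intro]: "x \<in> K \<Longrightarrow> y \<in> K \<Longrightarrow> x / y \<in> K"
  unfolding divide_inverse by auto

lemma K_power [intro]: "x \<in> K \<Longrightarrow> x ^ n \<in> K"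
  by (induction n) (auto intro: K_rat)

lemma rat_adjoin_sqrt_eq: "rat_adjoin_sqrt D = K"
proof
  show "rat_adjoin_sqrt D \<subseteq> K"
  proof
    fix x assume "x \<in> rat_adjoin_sqrt D"
    then have "x \<in> generate_field complex_field {om}" by (simp add: rat_adjoin_sqrt_def om_def)
    then show "x \<in> K"
      by (induction rule: generate_field.induct) (simp_all add: K_om K_rat K_add K_mult K_inverse K_uminus)
  qed
  show "K \<subseteq> rat_adjoin_sqrt D"
  proof
    fix z assume "z \<in> K"
    then obtain x y where e: "z = x + y * om" "x \<in> \<rat>" "y \<in> \<rat>" unfolding K_def by blast
    have "om \<in> generate_field complex_field {om}" by (rule generate_field.incl) simp
    from generate_field.eng_add[OF Rats_generate_field[OF e(2)]
        generate_field.eng_mult[OF Rats_generate_field[OF e(3)] this]]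
    show "z \<in> rat_adjoin_sqrt D" by (simp add: rat_adjoin_sqrt_def om_def e(1))
  qed
qed

lemma subfield_K: "subfield K complex_field"
proof (rule field.subfieldI'[OF field_from_type_algebra])
  show "subring K complex_field"
    by (rule complex_field.subringI) (simp_all add: K_rat K_add K_mult K_uminus)
qed (simp add: K_inverse)

text \<open>The dimension is read off the flag \<open>{0}\<close>, \<open>\<rat>\<close>,
  \<open>K\<close>: adjoining a line through an element outside the previous space raises it by one,
  first with 1 and then with the irrational \<open>om\<close>.\<close>

lemma dimension_K: "ring.dimension complex_field 2 \<rat> K"
proof -
  have li: "complex_field.line_extension F a E = {k * a + e | k e. k \<in> F \<and> e \<in> E}" for F a E
    unfolding complex_field.line_extension_def set_add_def set_mult_def r_coset_def by force
  have one: "complex_field.dimension (Suc 0) \<rat> (complex_field.line_extension \<rat> 1 {0})"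
    using complex_field.Suc_dim[OF _ _ complex_field.zero_dim, of 1 \<rat>] by simp
  have R: "complex_field.line_extension \<rat> 1 {0} = \<rat>"
    unfolding li by simp
  have "om \<notin> \<rat>" using Rats_real_complex(1)[of om] Re_om om_nonzero by force
  then have "complex_field.dimension (Suc (Suc 0)) \<rat> (complex_field.line_extension \<rat> om \<rat>)"
    using complex_field.Suc_dim[of om \<rat> "Suc 0" \<rat>] one R by simp
  moreover have "complex_field.line_extension \<rat> om \<rat> = K"
    unfolding K_def by (simp only: li add.commute[of "_ * om"]) blast
  ultimately show ?thesis unfolding numeral_2_eq_2 by simp
qed

lemma imaginary_quadratic: "imaginary_quadratic_field (rat_adjoin_sqrt D)"
  unfolding imaginary_quadratic_field_def rat_adjoin_sqrt_eq
proof (intro conjI subfield_K dimension_K)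
  have "om \<notin> \<real>" using Im_om by (simp add: complex_is_Real_iff)
  then show "\<not> K \<subseteq> \<real>" using K_om by blast
qed

end

lemma rat_adjoin_sqrt_mult_square:
  assumes "D < 0" "s \<noteq> 0"
  shows "rat_adjoin_sqrt (D * s ^ 2) = rat_adjoin_sqrt D"
proof -
  interpret A: imaginary_sqrt D by (rule imaginary_sqrt.intro) fact
  interpret B: imaginary_sqrt "D * s ^ 2" 
    using assms by (auto intro!: imaginary_sqrt.intro mult_neg_pos)
  \<comment> \<open>The absolute value appears because \<open>csqrt\<close> of a negative real
    always has positive imaginary part.\<close>
  have e: "B.om = of_int \<bar>s\<bar> * A.om"
    by (simp add: A.om_alt B.om_alt abs_mult real_sqrt_mult flip: of_int_abs)
  have "A.om = of_int 1 / of_int \<bar>s\<bar> * B.om" using assms(2) by (simp add: e)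
  moreover have "of_int 1 / of_int \<bar>s\<bar> \<in> (\<rat> :: complex set)" by auto
  ultimately have "A.om \<in> B.K" using B.K_om B.K_mult B.K_rat by metis
  then have "A.K \<subseteq> B.K" using B.K_add B.K_mult B.K_rat by (auto simp: A.K_def)
  moreover have "B.om \<in> A.K" unfolding e by (intro A.K_mult A.K_rat A.K_om) auto
  then have "B.K \<subseteq> A.K" using A.K_add A.K_mult A.K_rat by (auto simp: B.K_def)
  ultimately have "A.K = B.K" by blast
  then show ?thesis by (simp add: A.rat_adjoin_sqrt_eq B.rat_adjoin_sqrt_eq)
qed

subsection \<open>The ring of integers\<close>

text \<open>If \<open>b\<close> is the reduced denominator of \<open>r\<close>, every power of
  \<open>b\<close> divides the fixed nonzero \<open>d\<close>, which forces
  \<open>b = 1\<close>.\<close>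

lemma Rats_bounded_denominators:
  fixes r :: real
  assumes "r \<in> \<rat>" "d \<noteq> 0" and int: "\<And>j. of_int d * r ^ j \<in> \<int>"
  shows "r \<in> \<int>"
proof -
  obtain a b where ab: "b > 0" "coprime a b" "r = of_int a / of_int b"
    using assms(1) by (rule Rats_cases')
  have dvd: "b ^ j dvd d" for j
  proof -
    obtain z where z: "of_int d * r ^ j = of_int z" using int[of j] by (rule Ints_cases)
    then have "of_int (d * a ^ j) = (of_int (z * b ^ j) :: real)"
      using ab(1) by (simp add: ab(3) power_divide field_simps)
    then have "b ^ j dvd d * a ^ j" by (simp only: of_int_eq_iff dvd_triv_right)
    moreover have "coprime (b ^ j) (a ^ j)" using ab(2) by (simp add: coprime_commute)
    ultimately show ?thesis by (simp add: coprime_dvd_mult_left_iff)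
  qed
  have "b = 1"
  proof (rule ccontr)
    assume "b \<noteq> 1"
    \<comment> \<open>The exponent \<open>nat \<bar>d\<bar>\<close> is large enough, since
      \<open>2 ^ n\<close> exceeds \<open>n\<close>.\<close>
    then have "2 ^ nat \<bar>d\<bar> \<le> b ^ nat \<bar>d\<bar>" using ab(1) by (intro power_mono) auto
    moreover have "b ^ nat \<bar>d\<bar> \<le> \<bar>d\<bar>" using dvd_imp_le_int[OF assms(2) dvd] ab(1) by simp
    moreover have "int (nat \<bar>d\<bar>) < 2 ^ nat \<bar>d\<bar>" by (rule of_nat_less_two_power)
    ultimately show False by simp
  qed
  then show ?thesis using ab(3) by simp
qed

section \<open>Trace and norm of algebraic integers of the field\<close>

context imaginary_sqrt
begin

lemma zring_K: "x \<in> zring om \<Longrightarrow> x \<in> K"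
  unfolding zring_def by clarify (intro K_add K_mult K_om K_rat; simp)

lemma zring_cnj [intro]: "x \<in> zring om \<Longrightarrow> cnj x \<in> zring om"
  unfolding zring_def
  by (clarify, rename_tac a b, rule_tac x = a in exI, rule_tac x = "- b" in exI) simp

lemma zring_norm:
  assumes "x \<in> zring om" obtains n where "x * cnj x = of_int n"
proof -
  have "x * cnj x \<in> zring om" using assms by (intro zring_mult[OF om_square]) auto
  then obtain n where "Re (x * cnj x) = of_int n" using Re_zring[OF Re_om] by (metis Ints_cases)
  then have "x * cnj x = of_int n" by (simp add: complex_eq_iff)
  then show ?thesis by (rule that)
qed

lemma algebraic_int_zring:
  assumes "x \<in> zring om" shows "algebraic_int x"
proof -
  obtain n where n: "x * cnj x = of_int n" using assms by (rule zring_norm)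
  have "x + cnj x \<in> zring om" using assms by blast
  then have "Re (x + cnj x) \<in> \<int>" using Re_zring[OF Re_om] by blast
  then obtain t where "Re (x + cnj x) = of_int t" by (rule Ints_cases)
  then have t: "x + cnj x = of_int t" by (simp add: complex_eq_iff)
  show ?thesis
  proof (rule algebraic_int.intros)
    show "lead_coeff [:of_int n, - of_int t, 1:] = 1" by simp
    show "\<forall>i. coeff [:of_int n, - of_int t, 1:] i \<in> \<int>"
      by (auto simp: coeff_pCons split: nat.splits)
    show "poly [:of_int n, - of_int t, 1:] x = 0"
      unfolding n[symmetric] t[symmetric] by (simp add: algebra_simps)
  qed
qed

lemma K_denominator:
  assumes "z \<in> K" obtains e :: int where "e > 0" "of_int e * z \<in> zring om"
proof -
  obtain x y where e: "z = x + y * om" "x \<in> \<rat>" "y \<in> \<rat>" using assms unfolding K_def by blast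
  obtain a b where ab: "b > 0" "x = of_int a / of_int b" using e(2) by (rule Rats_cases')
  obtain c d where cd: "d > 0" "y = of_int c / of_int d" using e(3) by (rule Rats_cases')
  have xb: "x * of_int b = of_int a" and yd: "y * of_int d = of_int c"
    using ab cd by auto
  have "of_int (b * d) * z = (x * of_int b) * of_int d + (y * of_int d) * of_int b * om"
    unfolding e(1) by (simp add: algebra_simps)
  also have "\<dots> = of_int (a * d) + of_int (c * b) * om"
    unfolding xb yd by simp
  finally have eq: "of_int (b * d) * z = of_int (a * d) + of_int (c * b) * om" .
  have "of_int (b * d) * z \<in> zring om" unfolding zring_def eq by blast
  moreover have "b * d > 0" using ab cd by simp
  ultimately show ?thesis using that by blast
qed

text \<open>A monic equation of degree \<open>n\<close> expresses \<open>z ^ n\<close> by lower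
  powers with integer coefficients. So if \<open>e\<close> clears the denominators of
  \<open>z\<close>, then \<open>e ^ n\<close> clears those of all powers: directly below
  \<open>n\<close>, by the recurrence from \<open>n\<close> on.\<close>

lemma algebraic_int_bounded_denominators:
  assumes "z \<in> K" "algebraic_int z"
  obtains d :: int where "d > 0" "\<And>j. of_int d * z ^ j \<in> zring om"
proof -
  obtain e :: int where e: "e > 0" "of_int e * z \<in> zring om" using assms(1) by (rule K_denominator)
  obtain p where p: "lead_coeff p = 1" "\<forall>i. coeff p i \<in> \<int>" "poly p z = 0"
    using assms(2) by (auto elim: algebraic_int.cases)
  define n where "n = degree p"
  have rec: "z ^ n = - (\<Sum>i<n. coeff p i * z ^ i)"
  proof -
    have "0 = (\<Sum>i\<le>n. coeff p i * z ^ i)" using p(3) by (simp add: poly_altdef n_def)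
    also have "\<dots> = (\<Sum>i<n. coeff p i * z ^ i) + z ^ n"
      using p(1) by (simp add: lessThan_Suc_atMost[symmetric] n_def)
    finally show ?thesis by (metis add_eq_0_iff)
  qed
  have "of_int (e ^ n) * z ^ j \<in> zring om" for j
  proof (induction j rule: less_induct)
    case (less j)
    show ?case
    proof (cases "j < n")
      case True
      then have "of_int (e ^ n) * z ^ j = of_int (e ^ (n - j)) * (of_int e * z) ^ j"
        by (simp add: power_mult_distrib flip: power_add)
      then show ?thesis using e(2) by (simp add: zring_mult[OF om_square] zring_power[OF om_square] flip: of_int_power)
    next
      case False
      then have "z ^ j = z ^ (j - n) * z ^ n" by (simp flip: power_add)
      then have "of_int (e ^ n) * z ^ j = - (\<Sum>i<n. coeff p i * (of_int (e ^ n) * z ^ (j - n + i)))"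
        unfolding rec by (simp add: sum_distrib_left power_add algebra_simps)
      also have "\<dots> \<in> zring om"
      proof (rule zring_uminus, rule zring_sum, rule zring_mult[OF om_square])
        fix i assume "i \<in> {..<n}"
        then have "j - n + i < j" using False by simp
        then show "of_int (e ^ n) * z ^ (j - n + i) \<in> zring om" by (rule less)
        show "coeff p i \<in> zring om" using p(2) by (metis Ints_cases zring_of_int)
      qed
      finally show ?thesis .
    qed
  qed
  then show ?thesis using that[of "e ^ n"] e(1) by simp
qed

text \<open>Multiplying \<open>d * z ^ j\<close> by its conjugate shows that the powers of the norm
  have the common denominator \<open>d * d\<close>; a rational number with this property is an
  integer.\<close>

lemma norm_in_Ints:
  assumes "z \<in> K" "d > 0" and d: "\<And>j. of_int d * z ^ j \<in> zring om"
  shows "(cmod z) ^ 2 \<in> \<int>"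
proof (rule Rats_bounded_denominators)
  have "of_real ((cmod z) ^ 2) \<in> (\<rat> :: complex set)"
    unfolding complex_norm_square using assms(1) by (rule K_norm)
  then show "(cmod z) ^ 2 \<in> \<rat>" using Rats_real_complex(2) by fastforce
  show "d * d \<noteq> 0" using assms(2) by simp
  fix j
  have "(of_int d * z ^ j) * cnj (of_int d * z ^ j) \<in> zring om"
    using d[of j] zring_cnj[OF d[of j]] by (rule zring_mult[OF om_square])
  also have "(of_int d * z ^ j) * cnj (of_int d * z ^ j) = of_int (d * d) * (z * cnj z) ^ j"
    by (simp add: power_mult_distrib algebra_simps)
  also have "\<dots> = of_real (of_int (d * d) * ((cmod z) ^ 2) ^ j)"
    unfolding complex_norm_square[symmetric] by simp
  finally show "of_int (d * d) * ((cmod z) ^ 2) ^ j \<in> \<int>" using Re_zring[OF Re_om] by fastforce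
qed

lemma algebraic_int_trace_norm:
  assumes "z \<in> K" "algebraic_int z"
  shows "(cmod z) ^ 2 \<in> \<int>" "2 * Re z \<in> \<int>"
proof -
  obtain d where d: "d > 0" "\<And>j. of_int d * z ^ j \<in> zring om"
    using algebraic_int_bounded_denominators[OF assms] by blast
  show 1: "(cmod z) ^ 2 \<in> \<int>" using assms(1) d by (rule norm_in_Ints)
  \<comment> \<open>The same \<open>d\<close> serves for \<open>z + 1\<close>, by the binomial
    theorem. The trace is then the difference of the norms of \<open>z + 1\<close> and
    \<open>z\<close>, minus 1.\<close>
  have "of_int d * (z + 1) ^ j \<in> zring om" for j
  proof -
    have eq: "of_int d * (z + 1) ^ j = (\<Sum>k\<le>j. of_nat (j choose k) * (of_int d * z ^ k))"
      unfolding binomial_ring by (simp add: sum_distrib_left mult.left_commute mult.assoc)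
    show ?thesis unfolding eq by (rule zring_sum, rule zring_mult[OF om_square]) (simp_all add: d(2))
  qed
  then have 2: "(cmod (z + 1)) ^ 2 \<in> \<int>"
    using assms(1) d(1) by (intro norm_in_Ints K_add[OF _ K_rat]) auto
  have "2 * Re z = (cmod (z + 1)) ^ 2 - (cmod z) ^ 2 - 1"
    unfolding cmod_power2 by (simp add: power2_eq_square algebra_simps)
  then show "2 * Re z \<in> \<int>" using 1 2 by simp
qed

end

section \<open>Integers for a square-free radicand congruent to 3 modulo 4\<close>

locale imaginary_sqrt_3_mod_4 = imaginary_sqrt +
  assumes squarefree: "squarefree D" and mod_4: "D mod 4 = 3"
begin

text \<open>Write \<open>2 * x = a\<close> and \<open>2 * y = p / q\<close>. The norm gives
  \<open>p ^ 2 * D = (a ^ 2 - 4 * n) * q ^ 2\<close>, so \<open>q ^ 2\<close> divides the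
  square-free \<open>D\<close> and \<open>q = 1\<close>; the residue of \<open>D\<close> then makes
  \<open>a\<close> and \<open>p\<close> even. Integrality is thereby tested on trace and norm alone,
  which later decides whether quotients are integral.\<close>

lemma zringI:
  assumes "z \<in> K" "(cmod z) ^ 2 \<in> \<int>" "2 * Re z \<in> \<int>"
  shows "z \<in> zring om"
proof -
  obtain x y where e: "z = x + y * om" "x \<in> \<rat>" "y \<in> \<rat>" using assms(1) unfolding K_def by blast
  have "2 * y \<in> \<rat>" using e(3) by simp
  then obtain p q where pq: "q > 0" "coprime p q" "2 * y = of_int p / of_int q" by (rule Rats_cases')
  obtain a where a: "2 * Re z = of_int a" using assms(3) by (rule Ints_cases)
  obtain n where n: "(cmod z) ^ 2 = of_int n" using assms(2) by (rule Ints_cases)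
  have x: "2 * x = of_int a"
    using a Re_Im_K[OF e(2,3)] Rats_real_complex(1)[OF e(2)] e(1)
    by (metis of_real_mult of_real_numeral of_real_of_int_eq)
  have "of_int n = z * cnj z" using n complex_norm_square[of z] by (metis of_real_of_int_eq)
  also have "\<dots> = x * x - y * y * of_int D"
    unfolding om_square[symmetric] e(1) cnj_K_form[OF e(2,3)] by (simp add: algebra_simps power2_eq_square)
  finally have "4 * of_int n = (2 * x) * (2 * x) - (2 * y) * (2 * y) * of_int D" by simp
  then have "4 * of_int n * of_int q * of_int q =
      of_int a * of_int a * of_int q * of_int q - of_int p * of_int p * (of_int D :: complex)"
    using pq(1) unfolding x pq(3) by (simp add: field_simps)
  then have "of_int (p ^ 2 * D) = (of_int ((a ^ 2 - 4 * n) * q ^ 2) :: complex)"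
    by (simp add: algebra_simps power2_eq_square)
  then have eq: "p ^ 2 * D = (a ^ 2 - 4 * n) * q ^ 2" by (simp only: of_int_eq_iff)
  have "coprime (q ^ 2) (p ^ 2)" using pq(2) by (simp add: coprime_commute)
  moreover have "q ^ 2 dvd p ^ 2 * D" unfolding eq by simp
  ultimately have "q ^ 2 dvd D" by (simp add: coprime_dvd_mult_right_iff)
  then have "q = 1" using squarefreeD[OF squarefree] pq(1) by force
  then have eq': "p ^ 2 * D = a ^ 2 - 4 * n" using eq by simp
  have ev: "even a \<and> even p"
  proof -
    obtain D' where D': "D = 4 * D' + 3" using mod_4 by (metis mult_div_mod_eq)
    \<comment> \<open>Since \<open>D\<close> is \<open>- 1\<close> modulo 4, the norm equation
      becomes a sum of two squares divisible by 4, which is impossible with an odd summand.\<close>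
    have "4 dvd a ^ 2 + p ^ 2"
    proof
      show "a ^ 2 + p ^ 2 = 4 * (n + p ^ 2 * D' + p ^ 2)" using eq' unfolding D' by (simp add: algebra_simps)
    qed
    moreover have "\<exists>k. even u \<and> u ^ 2 = 4 * k \<or> odd u \<and> u ^ 2 = 4 * k + 1" for u :: int
    proof (cases "even u")
      case True
      then obtain v where "u = 2 * v" by blast
      then have "u ^ 2 = 4 * v ^ 2" by (simp add: power_mult_distrib)
      then show ?thesis using True by blast
    next
      case False
      then obtain v where "u = 2 * v + 1" by (blast elim: oddE)
      then have "u ^ 2 = 4 * (v ^ 2 + v) + 1" by (simp add: power2_eq_square algebra_simps)
      then show ?thesis using False by blast
    qed
    then obtain k l where "even a \<and> a ^ 2 = 4 * k \<or> odd a \<and> a ^ 2 = 4 * k + 1"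
        "even p \<and> p ^ 2 = 4 * l \<or> odd p \<and> p ^ 2 = 4 * l + 1" by meson
    ultimately show ?thesis by presburger
  qed
  then obtain a' p' where "a = 2 * a'" "p = 2 * p'" by (metis evenE)
  then have "x = of_int a'" "y = of_int p'" using x pq(3) \<open>q = 1\<close> by auto
  then show ?thesis unfolding e(1) zring_def by blast
qed

lemma ring_of_integers_carrier: "carrier (ring_of_integers K) = zring om"
proof -
  have "{x \<in> K. algebraic_int x} = zring om"
    using zringI algebraic_int_trace_norm algebraic_int_zring zring_K by blast
  then show ?thesis by (simp add: ring_of_integers_def)
qed

end

subsection \<open>Fractional ideals\<close>

abbreviation mprod :: "complex set \<Rightarrow> complex set \<Rightarrow> complex set" (infixl "\<bullet>" 80) where
  "I \<bullet> J \<equiv> ideal_prod complex_field I J"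

lemma mprod_mult: "i \<in> I \<Longrightarrow> j \<in> J \<Longrightarrow> i * j \<in> I \<bullet> J"
  using ideal_prod.prod[of i I j J complex_field] by simp

lemma mprod_add: "x \<in> I \<bullet> J \<Longrightarrow> y \<in> I \<bullet> J \<Longrightarrow> x + y \<in> I \<bullet> J"
  using ideal_prod.sum[of x complex_field I J y] by simp

lemma mprod_least:
  assumes "\<And>i j. i \<in> I \<Longrightarrow> j \<in> J \<Longrightarrow> i * j \<in> M"
    and "\<And>x y. x \<in> M \<Longrightarrow> y \<in> M \<Longrightarrow> x + y \<in> M"
  shows "I \<bullet> J \<subseteq> M"
proof
  fix x assume "x \<in> I \<bullet> J"
  then show "x \<in> M" by (induction rule: ideal_prod.induct) (simp_all add: assms)
qed

lemma mprod_mono: "I \<subseteq> I' \<Longrightarrow> J \<subseteq> J' \<Longrightarrow> I \<bullet> J \<subseteq> I' \<bullet> J'"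
  by (rule mprod_least, rule mprod_mult) (blast, blast, rule mprod_add)

lemma mprod_commute: "I \<bullet> J = J \<bullet> I"
proof -
  have "I \<bullet> J \<subseteq> J \<bullet> I" for I J
  proof (rule mprod_least)
    fix i j assume "i \<in> I" "j \<in> J"
    then have "j * i \<in> J \<bullet> I" by (intro mprod_mult)
    then show "i * j \<in> J \<bullet> I" by (simp add: mult.commute)
  qed (rule mprod_add)
  then show ?thesis by blast
qed

lemma mprod_assoc: "(I \<bullet> J) \<bullet> L = I \<bullet> (J \<bullet> L)"
proof -
  have le: "(I \<bullet> J) \<bullet> L \<subseteq> I \<bullet> (J \<bullet> L)" for I J L
  proof (rule mprod_least)
    fix x l assume "x \<in> I \<bullet> J" and l: "l \<in> L"
    then show "x * l \<in> I \<bullet> (J \<bullet> L)"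
    proof (induction rule: ideal_prod.induct)
      case (prod i j)
      then have "i * (j * l) \<in> I \<bullet> (J \<bullet> L)" using l by (intro mprod_mult)
      then show ?case by (simp add: mult.assoc)
    next
      case (sum s1 s2)
      then show ?case by (simp add: distrib_right mprod_add)
    qed
  qed (rule mprod_add)
  \<comment> \<open>By commutativity the reverse inclusion is the one already shown, with the
    factors in opposite order.\<close>
  have "I \<bullet> (J \<bullet> L) = (L \<bullet> J) \<bullet> I" by (metis mprod_commute)
  also have "\<dots> \<subseteq> L \<bullet> (J \<bullet> I)" by (rule le)
  also have "\<dots> = (I \<bullet> J) \<bullet> L" by (metis mprod_commute)
  finally show ?thesis using le by blast
qed

lemma cnj_mprod: "cnj ` (I \<bullet> J) = (cnj ` I) \<bullet> (cnj ` J)"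
proof -
  have le: "cnj ` (I \<bullet> J) \<subseteq> (cnj ` I) \<bullet> (cnj ` J)" for I J
  proof clarify
    fix x assume "x \<in> I \<bullet> J"
    then show "cnj x \<in> (cnj ` I) \<bullet> (cnj ` J)"
      by (induction rule: ideal_prod.induct) (auto intro: mprod_mult mprod_add)
  qed
  \<comment> \<open>Conjugation is an involution, so the inclusion for the conjugated factors yields
    the reverse one.\<close>
  have "cnj ` ((cnj ` I) \<bullet> (cnj ` J)) \<subseteq> I \<bullet> J"
    using le[of "cnj ` I" "cnj ` J"] by (simp add: image_image)
  then have "cnj ` (cnj ` ((cnj ` I) \<bullet> (cnj ` J))) \<subseteq> cnj ` (I \<bullet> J)" by blast
  then have "(cnj ` I) \<bullet> (cnj ` J) \<subseteq> cnj ` (I \<bullet> J)" by (simp add: image_image)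
  then show ?thesis using le[of I J] by blast
qed

lemma mprod_scale: "((*) a ` I) \<bullet> J = (*) a ` (I \<bullet> J)"
proof
  show "((*) a ` I) \<bullet> J \<subseteq> (*) a ` (I \<bullet> J)"
  proof (rule mprod_least)
    fix x y assume "x \<in> (*) a ` (I \<bullet> J)" "y \<in> (*) a ` (I \<bullet> J)"
    then obtain u v where uv: "x = a * u" "y = a * v" "u \<in> I \<bullet> J" "v \<in> I \<bullet> J" by blast
    then have "x + y = a * (u + v)" by (simp add: distrib_left)
    then show "x + y \<in> (*) a ` (I \<bullet> J)" using mprod_add[OF uv(3,4)] by blast
  next
    fix x j assume "x \<in> (*) a ` I" and j: "j \<in> J"
    then obtain i where i: "x = a * i" "i \<in> I" by blast
    then have "x * j = a * (i * j)" by simp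
    then show "x * j \<in> (*) a ` (I \<bullet> J)" using mprod_mult[OF i(2) j] by blast
  qed
  show "(*) a ` (I \<bullet> J) \<subseteq> ((*) a ` I) \<bullet> J"
  proof clarify
    fix x assume "x \<in> I \<bullet> J"
    then show "a * x \<in> ((*) a ` I) \<bullet> J"
    proof (induction rule: ideal_prod.induct)
      case (prod i j)
      then have "(a * i) * j \<in> ((*) a ` I) \<bullet> J" by (intro mprod_mult) auto
      then show ?case by (simp add: mult.assoc)
    next
      case (sum s1 s2)
      then show ?case by (simp add: distrib_left mprod_add)
    qed
  qed
qed

text \<open>The generator is the least positive element, by division with remainder, or 0 when there
  is no positive element.\<close>

lemma int_ideal_principal:
  fixes A :: "int set"
  assumes "a \<in> A" and add: "\<And>x y. x \<in> A \<Longrightarrow> y \<in> A \<Longrightarrow> x + y \<in> A"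
    and mult: "\<And>k x. x \<in> A \<Longrightarrow> k * x \<in> A"
  obtains g where "g \<in> A" "\<And>x. x \<in> A \<Longrightarrow> g dvd x"
proof (cases "\<exists>x \<in> A. x > 0")
  case False
  have "x = 0" if "x \<in> A" for x
    using False mult[OF that, of "- 1"] that by (metis linorder_neqE_linordered_idom mult_minus1 neg_0_less_iff_less)
  then show ?thesis using that[of a] assms(1) by force
next
  case True
  define P where "P = (\<lambda>n. n > 0 \<and> int n \<in> A)"
  define n where "n = (LEAST n. P n)"
  obtain x where "x \<in> A" "x > 0" using True by blast
  then have "P (nat x)" unfolding P_def by simp
  then have n: "P n" unfolding n_def by (rule LeastI)
  show ?thesis
  proof (rule that)
    show "int n \<in> A" using n unfolding P_def by blast
    fix y assume y: "y \<in> A"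
    have "y mod int n = y + (- (y div int n)) * int n" by (simp add: minus_div_mult_eq_mod[symmetric])
    also have "\<dots> \<in> A" using n y unfolding P_def by (intro add mult) auto
    finally have m: "y mod int n \<in> A" .
    have n0: "int n > 0" using n unfolding P_def by simp
    have "nat (y mod int n) < n" using n0 pos_mod_bound[OF n0, of y] pos_mod_sign[OF n0, of y] by linarith
    then have "\<not> P (nat (y mod int n))" unfolding n_def by (rule not_less_Least)
    then have "y mod int n = 0" using m pos_mod_sign[OF n0, of y] unfolding P_def by auto
    then show "int n dvd y" by (simp add: dvd_eq_mod_eq_0)
  qed
qed

section \<open>Fractional ideals of the ring of integers and their inverses\<close>

context imaginary_sqrt_3_mod_4
begin

abbreviation "\<O> \<equiv> zring om"

lemmas O_mult = zring_mult[OF om_square]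

text \<open>An elementwise form of \<open>fractional_ideal K\<close>, matched by
  \<open>fractional_ideal_iff\<close>. Closure under negation is contained in closure under
  multiplication by \<open>- 1\<close>.\<close>

definition frac_ideal :: "complex set \<Rightarrow> bool" where
  "frac_ideal I \<longleftrightarrow> I \<subseteq> K \<and> I \<noteq> {0} \<and> 0 \<in> I \<and> (\<forall>x \<in> I. \<forall>y \<in> I. x + y \<in> I) \<and>
     (\<forall>a \<in> \<O>. \<forall>x \<in> I. a * x \<in> I) \<and> (\<exists>d \<in> \<O>. d \<noteq> 0 \<and> (\<forall>x \<in> I. d * x \<in> \<O>))"

lemma fracD:
  assumes "frac_ideal I"
  shows "I \<subseteq> K" "0 \<in> I" "x \<in> I \<Longrightarrow> y \<in> I \<Longrightarrow> x + y \<in> I" "a \<in> \<O> \<Longrightarrow> x \<in> I \<Longrightarrow> a * x \<in> I"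
    "\<exists>x \<in> I. x \<noteq> 0" "\<exists>d \<in> \<O>. d \<noteq> 0 \<and> (\<forall>x \<in> I. d * x \<in> \<O>)"
proof -
  note a = assms[unfolded frac_ideal_def]
  show "I \<subseteq> K" "0 \<in> I" "x \<in> I \<Longrightarrow> y \<in> I \<Longrightarrow> x + y \<in> I" "a \<in> \<O> \<Longrightarrow> x \<in> I \<Longrightarrow> a * x \<in> I"
    "\<exists>d \<in> \<O>. d \<noteq> 0 \<and> (\<forall>x \<in> I. d * x \<in> \<O>)"
    using a by simp_all
  have "I \<noteq> {0}" "0 \<in> I" using a by simp_all
  then show "\<exists>x \<in> I. x \<noteq> 0" by fast
qed

lemma fracI:
  assumes "I \<subseteq> K" "0 \<in> I" "\<And>x y. x \<in> I \<Longrightarrow> y \<in> I \<Longrightarrow> x + y \<in> I"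
    "\<And>a x. a \<in> \<O> \<Longrightarrow> x \<in> I \<Longrightarrow> a * x \<in> I" "x \<in> I" "x \<noteq> 0"
    "d \<in> \<O>" "d \<noteq> 0" "\<And>x. x \<in> I \<Longrightarrow> d * x \<in> \<O>"
  shows "frac_ideal I"
  unfolding frac_ideal_def using assms by (intro conjI ballI bexI[of _ d]) (simp_all, blast)

lemma ring_of_integers_simps [simp]:
  "x \<otimes>\<^bsub>ring_of_integers K\<^esub> y = x * y" "x \<oplus>\<^bsub>ring_of_integers K\<^esub> y = x + y"
  "\<zero>\<^bsub>ring_of_integers K\<^esub> = 0" "\<one>\<^bsub>ring_of_integers K\<^esub> = 1"
  by (simp_all add: ring_of_integers_def)

lemma ring_ring_of_integers: "ring (ring_of_integers K)"
proof -
  have "subring \<O> complex_field"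
    by (rule complex_field.subringI) (auto intro: O_mult)
  then have "ring (complex_field \<lparr>carrier := \<O>\<rparr>)" by (rule complex_field.subring_is_ring)
  then show ?thesis using ring_of_integers_carrier by (simp add: ring_of_integers_def)
qed

lemma fractional_ideal_iff: "fractional_ideal K I \<longleftrightarrow> frac_ideal I"
proof
  assume "fractional_ideal K I"
  then obtain d where d: "I \<subseteq> K" "I \<noteq> {0}" "d \<in> \<O>" "d \<noteq> 0" "ideal ((*) d ` I) (ring_of_integers K)"
    unfolding fractional_ideal_def ring_of_integers_carrier by blast
  interpret J: ideal "(*) d ` I" "ring_of_integers K" by fact
  have "0 \<in> (*) d ` I" using additive_subgroup.zero_closed[OF J.additive_subgroup_axioms] by simp
  then have "0 \<in> I" using d(4) by auto
  moreover have "x + y \<in> I" if "x \<in> I" "y \<in> I" for x y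
  proof -
    have "d * x \<in> (*) d ` I" "d * y \<in> (*) d ` I" using that by blast+
    then have "d * x + d * y \<in> (*) d ` I" using additive_subgroup.a_closed[OF J.additive_subgroup_axioms, of "d * x" "d * y"] by simp
    then show ?thesis using d(4) by (auto simp flip: distrib_left)
  qed
  moreover have "a * x \<in> I" if "a \<in> \<O>" "x \<in> I" for a x
  proof -
    have "a * (d * x) \<in> (*) d ` I"
      using J.I_l_closed[of "d * x" a] imageI[OF that(2), of "(*) d"] that(1) by (simp add: ring_of_integers_carrier)
    then show ?thesis using d(4) by (auto simp: mult.left_commute)
  qed
  moreover have "d * x \<in> \<O>" if "x \<in> I" for x
    using J.a_subset that by (auto simp: ring_of_integers_carrier)
  moreover obtain x where "x \<in> I" "x \<noteq> 0" using d(2) \<open>0 \<in> I\<close> by fast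
  ultimately show "frac_ideal I" using d(1,3,4) by (intro fracI)
next
  assume "frac_ideal I"
  obtain d where d: "d \<in> \<O>" "d \<noteq> 0" "\<And>x. x \<in> I \<Longrightarrow> d * x \<in> \<O>"
    using fracD(6)[OF \<open>frac_ideal I\<close>] by auto
  have I: "I \<subseteq> K" "I \<noteq> {0}" "0 \<in> I" "\<And>x y. x \<in> I \<Longrightarrow> y \<in> I \<Longrightarrow> x + y \<in> I"
     "\<And>a x. a \<in> \<O> \<Longrightarrow> x \<in> I \<Longrightarrow> a * x \<in> I" "d \<in> \<O>" "d \<noteq> 0" "\<And>x. x \<in> I \<Longrightarrow> d * x \<in> \<O>"
    using fracD[OF \<open>frac_ideal I\<close>] d by auto
  interpret R: ring "ring_of_integers K" by (rule ring_ring_of_integers)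
  have minus: "\<ominus>\<^bsub>ring_of_integers K\<^esub> x = - x" if "x \<in> \<O>" for x
    using R.minus_equality[of "- x" x] that by (simp add: ring_of_integers_carrier zring_uminus)
  have "ideal ((*) d ` I) (ring_of_integers K)"
  proof (rule idealI[OF ring_ring_of_integers])
    show "subgroup ((*) d ` I) (add_monoid (ring_of_integers K))"
    proof (rule R.add.subgroupI)
      show "(*) d ` I \<subseteq> carrier (ring_of_integers K)" using I(8) by (auto simp: ring_of_integers_carrier)
      show "(*) d ` I \<noteq> {}" using I(3) by blast
    next
      fix x assume "x \<in> (*) d ` I"
      then obtain y where y: "y \<in> I" "x = d * y" by blast
      have "- 1 * y \<in> I" using y(1) by (intro I(5)) (auto intro!: zring_uminus)
      moreover have "- x = d * (- 1 * y)" using y(2) by simp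
      ultimately have "- x \<in> (*) d ` I" by (metis imageI)
      then show "\<ominus>\<^bsub>ring_of_integers K\<^esub> x \<in> (*) d ` I" using minus[of x] I(8) y by simp
    next
      fix x y assume "x \<in> (*) d ` I" "y \<in> (*) d ` I"
      then obtain u v where uv: "x = d * u" "y = d * v" "u \<in> I" "v \<in> I" by blast
      then have "x + y = d * (u + v)" by (simp add: distrib_left)
      then have "x + y \<in> (*) d ` I" using I(4)[OF uv(3,4)] by (metis imageI)
      then show "x \<oplus>\<^bsub>ring_of_integers K\<^esub> y \<in> (*) d ` I" by simp
    qed
  next
    fix u x assume "u \<in> (*) d ` I" and x: "x \<in> carrier (ring_of_integers K)"
    then obtain y where y: "y \<in> I" "u = d * y" by blast
    have "x * y \<in> I" using x y(1) by (intro I(5)) (simp add: ring_of_integers_carrier)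
    then have "d * (x * y) \<in> (*) d ` I" by (rule imageI)
    moreover have "x * u = d * (x * y)" "u * x = d * (x * y)" using y(2) by simp_all
    ultimately show "x \<otimes>\<^bsub>ring_of_integers K\<^esub> u \<in> (*) d ` I" "u \<otimes>\<^bsub>ring_of_integers K\<^esub> x \<in> (*) d ` I"
      by (simp_all only: ring_of_integers_simps)
  qed
  then show "fractional_ideal K I"
    unfolding fractional_ideal_def ring_of_integers_carrier using I(1,2,6,7) by (intro conjI bexI[of _ d])
qed

lemma frac_mprod:
  assumes "frac_ideal I" "frac_ideal J" shows "frac_ideal (I \<bullet> J)"
proof -
  obtain i j where ij: "i \<in> I" "i \<noteq> 0" "j \<in> J" "j \<noteq> 0" using fracD(5)[OF assms(1)] fracD(5)[OF assms(2)] by blast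
  obtain d e where de: "d \<in> \<O>" "d \<noteq> 0" "\<And>x. x \<in> I \<Longrightarrow> d * x \<in> \<O>"
     "e \<in> \<O>" "e \<noteq> 0" "\<And>x. x \<in> J \<Longrightarrow> e * x \<in> \<O>"
    using fracD(6)[OF assms(1)] fracD(6)[OF assms(2)] by auto
  show ?thesis
  proof (rule fracI)
    show "I \<bullet> J \<subseteq> K"
      using fracD(1)[OF assms(1)] fracD(1)[OF assms(2)] by (intro mprod_least) (auto intro: K_mult K_add)
    show "0 \<in> I \<bullet> J" using mprod_mult[OF fracD(2)[OF assms(1)] ij(3)] by simp
    show "i * j \<in> I \<bullet> J" "i * j \<noteq> 0" using ij by (auto intro: mprod_mult)
    show "d * e \<in> \<O>" "d * e \<noteq> 0" using de by (auto intro: O_mult)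
  next
    fix a x assume a: "a \<in> \<O>" and "x \<in> I \<bullet> J"
    from this(2) show "a * x \<in> I \<bullet> J"
    proof (induction rule: ideal_prod.induct)
      case (prod i j)
      then have "(a * i) * j \<in> I \<bullet> J" using a by (intro mprod_mult fracD(4)[OF assms(1)])
      then show ?case by (simp add: mult.assoc)
    next
      case (sum s1 s2)
      then show ?case by (simp add: distrib_left mprod_add)
    qed
  next
    fix x assume "x \<in> I \<bullet> J"
    then show "d * e * x \<in> \<O>"
    proof (induction rule: ideal_prod.induct)
      case (prod i j)
      then have "(d * i) * (e * j) \<in> \<O>" using O_mult[OF de(3) de(6)] by blast
      then show ?case by (simp add: mult_ac)
    next
      case (sum s1 s2)
      then show ?case by (simp add: distrib_left zring_add)
    qed
  qed (rule mprod_add)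
qed

lemma frac_O: "frac_ideal \<O>"
  by (rule fracI[where x = 1 and d = 1]) (auto intro: zring_K O_mult)

lemma frac_scale:
  assumes "frac_ideal I" "a \<in> K" "a \<noteq> 0" shows "frac_ideal ((*) a ` I)"
proof -
  obtain x where x: "x \<in> I" "x \<noteq> 0" using fracD(5)[OF assms(1)] by blast
  obtain d where d: "d \<in> \<O>" "d \<noteq> 0" "\<And>x. x \<in> I \<Longrightarrow> d * x \<in> \<O>" using fracD(6)[OF assms(1)] by auto
  obtain e :: int where e: "e > 0" "of_int e * a \<in> \<O>" using assms(2) by (rule K_denominator)
  show ?thesis
  proof (rule fracI)
    show "(*) a ` I \<subseteq> K" using fracD(1)[OF assms(1)] assms(2) by auto
    show "0 \<in> (*) a ` I" using fracD(2)[OF assms(1)] by force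
    show "a * x \<in> (*) a ` I" "a * x \<noteq> 0" using x assms(3) by (simp_all add: imageI)
    show "d * of_int e \<in> \<O>" "d * of_int e \<noteq> 0" using d e by (auto intro: O_mult)
  next
    fix x y assume "x \<in> (*) a ` I" "y \<in> (*) a ` I"
    then obtain u v where uv: "x = a * u" "y = a * v" "u \<in> I" "v \<in> I" by blast
    then have "x + y = a * (u + v)" by (simp add: distrib_left)
    then show "x + y \<in> (*) a ` I" using fracD(3)[OF assms(1) uv(3,4)] by blast
  next
    fix b x assume "b \<in> \<O>" "x \<in> (*) a ` I"
    then obtain u where u: "x = a * u" "u \<in> I" by blast
    then have "b * x = a * (b * u)" by simp
    then show "b * x \<in> (*) a ` I" using fracD(4)[OF assms(1) \<open>b \<in> \<O>\<close> u(2)] by blast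
  next
    fix x assume "x \<in> (*) a ` I"
    then obtain y where y: "y \<in> I" "x = a * y" by blast
    have "(of_int e * a) * (d * y) \<in> \<O>" using e(2) d(3)[OF y(1)] by (rule O_mult)
    then show "d * of_int e * x \<in> \<O>" unfolding y(2) by (simp add: mult_ac)
  qed
qed

lemma frac_cnj:
  assumes "frac_ideal I" shows "frac_ideal (cnj ` I)"
proof -
  obtain x where x: "x \<in> I" "x \<noteq> 0" using fracD(5)[OF assms(1)] by blast
  obtain d where d: "d \<in> \<O>" "d \<noteq> 0" "\<And>x. x \<in> I \<Longrightarrow> d * x \<in> \<O>" using fracD(6)[OF assms(1)] by auto
  show ?thesis
  proof (rule fracI)
    show "cnj ` I \<subseteq> K" using fracD(1)[OF assms(1)] by auto
    show "0 \<in> cnj ` I" using fracD(2)[OF assms(1)] by force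
    show "cnj x \<in> cnj ` I" "cnj x \<noteq> 0" using x by auto
    show "cnj d \<in> \<O>" "cnj d \<noteq> 0" using d by auto
  next
    fix x y assume "x \<in> cnj ` I" "y \<in> cnj ` I"
    then obtain u v where uv: "x = cnj u" "y = cnj v" "u \<in> I" "v \<in> I" by blast
    then have "x + y = cnj (u + v)" by simp
    then show "x + y \<in> cnj ` I" using fracD(3)[OF assms(1) uv(3,4)] by blast
  next
    fix b x assume "b \<in> \<O>" "x \<in> cnj ` I"
    then obtain y where y: "y \<in> I" "x = cnj y" by blast
    have "cnj b * y \<in> I" using fracD(4)[OF assms(1) _ y(1)] \<open>b \<in> \<O>\<close> by blast
    then show "b * x \<in> cnj ` I" unfolding y(2) by (rule image_eqI[rotated]) simp
  next
    fix x assume "x \<in> cnj ` I"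
    then obtain y where y: "y \<in> I" "x = cnj y" by blast
    show "cnj d * x \<in> \<O>" using zring_cnj[OF d(3)[OF y(1)]] unfolding y(2) by simp
  qed
qed

lemma mprod_O:
  assumes "frac_ideal I" shows "\<O> \<bullet> I = I"
proof
  show "\<O> \<bullet> I \<subseteq> I" using fracD(3,4)[OF assms] by (intro mprod_least)
  show "I \<subseteq> \<O> \<bullet> I" using mprod_mult[of 1 \<O> _ I] by force
qed

definition gen :: "complex \<Rightarrow> complex \<Rightarrow> complex set" where
  "gen x y = {a * x + b * y | a b. a \<in> \<O> \<and> b \<in> \<O>}"

lemma gen_add: "u \<in> gen x y \<Longrightarrow> v \<in> gen x y \<Longrightarrow> u + v \<in> gen x y"
proof -
  assume "u \<in> gen x y" "v \<in> gen x y"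
  then obtain a b a' b' where *: "u = a * x + b * y" "v = a' * x + b' * y" "a \<in> \<O>" "b \<in> \<O>" "a' \<in> \<O>" "b' \<in> \<O>"
    unfolding gen_def by blast
  then have "u + v = (a + a') * x + (b + b') * y" by (simp add: algebra_simps)
  then show "u + v \<in> gen x y" unfolding gen_def using zring_add[OF *(3,5)] zring_add[OF *(4,6)] by blast
qed

lemma gen_mult: "c \<in> \<O> \<Longrightarrow> u \<in> gen x y \<Longrightarrow> c * u \<in> gen x y"
proof -
  assume c: "c \<in> \<O>" and "u \<in> gen x y"
  then obtain a b where *: "u = a * x + b * y" "a \<in> \<O>" "b \<in> \<O>"
    unfolding gen_def by blast
  then have "c * u = (c * a) * x + (c * b) * y" by (simp add: algebra_simps)
  then show "c * u \<in> gen x y" unfolding gen_def using O_mult[OF c *(2)] O_mult[OF c *(3)] by blast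
qed

lemma gen_mem: "x \<in> gen x y" "y \<in> gen x y"
proof -
  have "x = 1 * x + 0 * y" "y = 0 * x + 1 * y" by simp_all
  then show "x \<in> gen x y" "y \<in> gen x y" unfolding gen_def using zring_numeral by blast+
qed

lemma gen_least:
  assumes "x \<in> M" "y \<in> M" "\<And>u v. u \<in> M \<Longrightarrow> v \<in> M \<Longrightarrow> u + v \<in> M" "\<And>a u. a \<in> \<O> \<Longrightarrow> u \<in> M \<Longrightarrow> a * u \<in> M"
  shows "gen x y \<subseteq> M"
  using assms unfolding gen_def by blast

lemma frac_gen:
  assumes "x \<in> \<O>" "y \<in> \<O>" "x \<noteq> 0"
  shows "frac_ideal (gen x y)"
proof (rule fracI[where d = 1 and x = x])
  have le: "gen x y \<subseteq> \<O>" using assms by (intro gen_least) (auto intro: O_mult)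
  then show "gen x y \<subseteq> K" "\<And>u. u \<in> gen x y \<Longrightarrow> 1 * u \<in> \<O>" using zring_K by auto
  show "0 \<in> gen x y" using gen_mult[OF _ gen_mem(1), of 0 x y] by simp
qed (use assms in \<open>auto intro: gen_add gen_mult gen_mem\<close>)

text \<open>A Hermite normal form: \<open>a\<close> generates the integers in \<open>L\<close>, and
  the second generator is an element of \<open>L\<close> whose \<open>om\<close>-coefficient
  \<open>b\<close> generates all \<open>om\<close>-coefficients occurring in
  \<open>L\<close>.\<close>

lemma two_generators:
  assumes sub: "L \<subseteq> \<O>" and zero: "0 \<in> L" and add: "\<And>x y. x \<in> L \<Longrightarrow> y \<in> L \<Longrightarrow> x + y \<in> L"
    and mult: "\<And>a x. a \<in> \<O> \<Longrightarrow> x \<in> L \<Longrightarrow> a * x \<in> L"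
  obtains x y where "x \<in> \<O>" "y \<in> \<O>" "L = gen x y"
proof -
  define A where "A = {a :: int. of_int a \<in> L}"
  define B where "B = {b :: int. \<exists>a :: int. of_int a + of_int b * om \<in> L}"
  have A0: "0 \<in> A" using zero by (simp add: A_def)
  have Aadd: "x + y \<in> A" if "x \<in> A" "y \<in> A" for x y using that add by (force simp: A_def)
  have Amult: "k * x \<in> A" if "x \<in> A" for k x using that mult[OF zring_of_int] by (force simp: A_def)
  obtain a where a: "a \<in> A" "\<And>x. x \<in> A \<Longrightarrow> a dvd x"
    using int_ideal_principal[OF A0 Aadd Amult] by blast
  have B0: "0 \<in> B" using zero unfolding B_def by (auto intro!: exI[of _ 0])
  have Badd: "x + y \<in> B" if B: "x \<in> B" "y \<in> B" for x y
  proof -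
    obtain c d :: int where "of_int c + of_int x * om \<in> L" "of_int d + of_int y * om \<in> L"
      using B unfolding B_def by blast
    then have "(of_int c + of_int x * om) + (of_int d + of_int y * om) \<in> L" by (rule add)
    also have "(of_int c + of_int x * om) + (of_int d + of_int y * om) = of_int (c + d) + of_int (x + y) * om"
      by (simp add: algebra_simps)
    finally show ?thesis unfolding B_def by blast
  qed
  have Bmult: "k * x \<in> B" if B: "x \<in> B" for k x
  proof -
    obtain c :: int where "of_int c + of_int x * om \<in> L"
      using B unfolding B_def by blast
    then have "of_int k * (of_int c + of_int x * om) \<in> L" by (rule mult[OF zring_of_int])
    also have "of_int k * (of_int c + of_int x * om) = of_int (k * c) + of_int (k * x) * om"
      by (simp add: algebra_simps)
    finally show ?thesis unfolding B_def by blast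
  qed
  obtain b where b: "b \<in> B" "\<And>x. x \<in> B \<Longrightarrow> b dvd x"
    using int_ideal_principal[OF B0 Badd Bmult] by blast
  obtain c :: int where c: "of_int c + of_int b * om \<in> L" using b(1) unfolding B_def by blast
  let ?z = "of_int c + of_int b * om"
  have aL: "of_int a \<in> L" using a(1) unfolding A_def by simp
  show ?thesis
  proof (rule that)
    show "of_int a \<in> \<O>" "?z \<in> \<O>" using sub c by auto
    show "L = gen (of_int a) ?z"
    proof
      show "gen (of_int a) ?z \<subseteq> L" using aL c add mult by (intro gen_least)
      show "L \<subseteq> gen (of_int a) ?z"
      proof
        fix w assume w: "w \<in> L"
        then obtain e f :: int where ef: "w = of_int e + of_int f * om" using sub unfolding zring_def by blast
        then have "f \<in> B" using w unfolding B_def by blast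
        then obtain k where k: "f = b * k" using b(2) by blast
        \<comment> \<open>Subtracting a multiple of the second generator removes the
          \<open>om\<close>-coefficient and leaves an integer of \<open>L\<close>, hence a multiple
          of \<open>a\<close>.\<close>
        have "w + of_int (- k) * ?z \<in> L" using add[OF w mult[OF zring_of_int c]] by blast
        also have "w + of_int (- k) * ?z = of_int (e - k * c)" unfolding ef k by (simp add: algebra_simps)
        finally have "e - k * c \<in> A" unfolding A_def by simp
        then obtain l where l: "e - k * c = a * l" using a(2) by blast
        have "w = of_int (e - k * c) + of_int k * ?z" unfolding ef k by (simp add: algebra_simps)
        also have "\<dots> = of_int l * of_int a + of_int k * ?z" unfolding l by (simp add: mult.commute)
        finally show "w \<in> gen (of_int a) ?z" unfolding gen_def by blast
      qed
    qed
  qed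
qed

text \<open>After scaling, the ideal is \<open>L = gen x y\<close>, and \<open>L\<close> times its
  conjugate is generated by the integer \<open>c\<close>, the gcd of the norms of \<open>x\<close>
  and \<open>y\<close> and the trace of \<open>x * cnj y\<close>. The conjugate of \<open>L\<close>
  is thus an inverse up to a scalar.\<close>

lemma frac_inverse:
  assumes "frac_ideal I" obtains J where "frac_ideal J" "I \<bullet> J = \<O>"
proof -
  obtain d where d: "d \<in> \<O>" "d \<noteq> 0" "\<And>x. x \<in> I \<Longrightarrow> d * x \<in> \<O>" using fracD(6)[OF assms] by auto
  define L where "L = (*) d ` I"
  have fL: "frac_ideal L" unfolding L_def using assms d by (intro frac_scale) (auto intro: zring_K)
  have "L \<subseteq> \<O>" unfolding L_def using d(3) by blast
  then obtain x y where xy: "x \<in> \<O>" "y \<in> \<O>" "L = gen x y"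
    using two_generators[of L] fracD(2,3,4)[OF fL] by metis
  obtain n1 where n1: "x * cnj x = of_int n1" using xy(1) by (rule zring_norm)
  obtain n2 where n2: "y * cnj y = of_int n2" using xy(2) by (rule zring_norm)
  obtain n3 where n3: "(x + y) * cnj (x + y) = of_int n3" using zring_add[OF xy(1,2)] by (rule zring_norm)
  \<comment> \<open>By polarisation of the norm, this is the trace of
    \<open>x * cnj y\<close>.\<close>
  define t where "t = n3 - n1 - n2"
  have t: "x * cnj y + y * cnj x = of_int t"
    using n1 n2 n3 unfolding t_def by (simp add: algebra_simps)
  define c where "c = gcd (gcd n1 n2) t"
  have "x \<noteq> 0 \<or> y \<noteq> 0"
  proof (rule ccontr)
    assume "\<not> (x \<noteq> 0 \<or> y \<noteq> 0)"
    then have "L \<subseteq> {0}" unfolding xy(3) gen_def by auto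
    then show False using fracD(5)[OF fL] by blast
  qed
  then have "n1 \<noteq> 0 \<or> n2 \<noteq> 0" using n1 n2 by auto
  then have c0: "c \<noteq> 0" unfolding c_def by auto
  obtain n1' n2' t' where dv: "n1 = c * n1'" "n2 = c * n2'" "t = c * t'"
    unfolding c_def by (meson dvd_def dvd_trans gcd_dvd1 gcd_dvd2)
  \<comment> \<open>Divided by \<open>c\<close>, a mixed product has norm \<open>n1' * n2'\<close>
    and trace \<open>t'\<close>; both are integers, so the quotient is integral by
    \<open>zringI\<close>. Stated for \<open>u\<close> and \<open>v\<close> because it is needed for
    \<open>x * cnj y\<close> and for \<open>y * cnj x\<close>.\<close>
  have mixed: "\<exists>w \<in> \<O>. u * cnj v = of_int c * w"
    if uv: "u \<in> \<O>" "v \<in> \<O>" "u * cnj v + v * cnj u = of_int t" "(u * cnj u) * (v * cnj v) = of_int (n1 * n2)" for u v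
  proof
    define w where "w = u * cnj v / of_int c"
    show "u * cnj v = of_int c * w" unfolding w_def using c0 by simp
    show "w \<in> \<O>"
    proof (rule zringI)
      show "w \<in> K" unfolding w_def using uv by (intro K_divide K_mult K_cnj zring_K) auto
      have "of_real ((cmod w) ^ 2) = (of_int (n1' * n2') :: complex)"
      proof -
        have "of_real ((cmod w) ^ 2) = w * cnj w" by (rule complex_norm_square)
        also have "\<dots> = (u * cnj u) * (v * cnj v) / (of_int c) ^ 2"
          unfolding w_def by (simp add: field_simps power2_eq_square)
        also have "\<dots> = of_int (n1' * n2')" unfolding uv(4) dv(1,2) using c0 by (simp add: power2_eq_square)
        finally show ?thesis .
      qed
      then have "(cmod w) ^ 2 = of_int (n1' * n2')" by (metis of_real_eq_iff of_real_of_int_eq)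
      then show "(cmod w) ^ 2 \<in> \<int>" by simp
      have "of_real (2 * Re w) = w + cnj w" by (simp add: complex_add_cnj)
      also have "\<dots> = (u * cnj v + v * cnj u) / of_int c"
        unfolding w_def by (simp add: add_divide_distrib mult.commute)
      also have "\<dots> = of_int t'" unfolding uv(3) dv(3) using c0 by simp
      finally have "2 * Re w = of_int t'" by (metis of_real_eq_iff of_real_of_int_eq)
      then show "2 * Re w \<in> \<int>" by simp
    qed
  qed
  have P: "L \<bullet> (cnj ` L) = (*) (of_int c) ` \<O>"
  proof
    have fc: "frac_ideal ((*) (of_int c) ` \<O>)" using c0 by (intro frac_scale frac_O) (auto intro: K_rat)
    obtain w1 where w1: "w1 \<in> \<O>" "x * cnj y = of_int c * w1"
      using mixed[OF xy(1,2) t] n1 n2 by auto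
    have "y * cnj x + x * cnj y = of_int t" "(y * cnj y) * (x * cnj x) = of_int (n1 * n2)"
      using t n1 n2 by (simp_all add: algebra_simps)
    then obtain w2 where w2: "w2 \<in> \<O>" "y * cnj x = of_int c * w2"
      using mixed[OF xy(2,1)] by auto
    show "L \<bullet> (cnj ` L) \<subseteq> (*) (of_int c) ` \<O>"
    proof (rule mprod_least)
      fix i j assume "i \<in> L" "j \<in> cnj ` L"
      then obtain a b a' b' where *: "i = a * x + b * y" "j = cnj (a' * x + b' * y)"
        "a \<in> \<O>" "b \<in> \<O>" "a' \<in> \<O>" "b' \<in> \<O>"
        unfolding xy(3) gen_def by blast
      have "i * j = a * cnj a' * (x * cnj x) + b * cnj b' * (y * cnj y)
          + a * cnj b' * (x * cnj y) + b * cnj a' * (y * cnj x)"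
        unfolding * by (simp add: algebra_simps)
      also have "\<dots> = of_int c * (a * cnj a' * of_int n1' + b * cnj b' * of_int n2'
          + a * cnj b' * w1 + b * cnj a' * w2)"
        unfolding n1 n2 w1 w2 dv by (simp add: algebra_simps)
      finally show "i * j \<in> (*) (of_int c) ` \<O>"
        using * w1(1) w2(1) by (auto intro!: imageI zring_add O_mult)
    qed (rule fracD(3)[OF fc])
    have fP: "frac_ideal (L \<bullet> (cnj ` L))" using fL by (intro frac_mprod frac_cnj)
    \<comment> \<open>Bezout coefficients write \<open>c\<close> as an integer combination of
      products of an element of \<open>L\<close> with a conjugate of one.\<close>
    obtain r s p q where bez: "gcd n1 n2 = r * n1 + s * n2" "c = p * gcd n1 n2 + q * t"
      unfolding c_def by (metis bezout_int)
    have mx: "x \<in> L" "y \<in> L" unfolding xy(3) by (rule gen_mem)+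
    have mm: "u * cnj v \<in> L \<bullet> (cnj ` L)" if "u \<in> L" "v \<in> L" for u v
      using that by (intro mprod_mult imageI)
    have "of_int (p * r) * (x * cnj x) + of_int (p * s) * (y * cnj y)
        + of_int q * (x * cnj y + y * cnj x) \<in> L \<bullet> (cnj ` L)"
      by (intro fracD(3)[OF fP] fracD(4)[OF fP zring_of_int] mm mx)
    also have "of_int (p * r) * (x * cnj x) + of_int (p * s) * (y * cnj y)
        + of_int q * (x * cnj y + y * cnj x) = of_int c"
      unfolding n1 n2 t bez by (simp add: algebra_simps)
    finally have "of_int c \<in> L \<bullet> (cnj ` L)" .
    then show "(*) (of_int c) ` \<O> \<subseteq> L \<bullet> (cnj ` L)"
      using fracD(4)[OF fP] by (auto simp: mult.commute)
  qed
  show ?thesis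
  proof (rule that)
    \<comment> \<open>As \<open>L\<close> is \<open>d\<close> times the given ideal, the factor
      \<open>d\<close> turns the product into \<open>L\<close> times its conjugate, and division by
      \<open>c\<close> normalises it to \<open>\<O>\<close>.\<close>
    show "frac_ideal ((*) (d / of_int c) ` (cnj ` L))"
      using fL c0 d(1,2) by (intro frac_scale frac_cnj K_divide) (simp_all add: zring_K)
    have "I \<bullet> ((*) (d / of_int c) ` (cnj ` L)) = (*) (d / of_int c) ` (I \<bullet> (cnj ` L))"
      using mprod_scale mprod_commute by metis
    also have "\<dots> = (*) (1 / of_int c) ` ((*) d ` (I \<bullet> (cnj ` L)))"
      by (simp add: image_image)
    also have "\<dots> = (*) (1 / of_int c) ` ((*) (of_int c) ` \<O>)"
      using P unfolding L_def mprod_scale by simp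
    also have "\<dots> = \<O>" using c0 by (simp add: image_image)
    finally show "I \<bullet> ((*) (d / of_int c) ` (cnj ` L)) = \<O>" .
  qed
qed

end

subsection \<open>The class of \<open>(m\<^sup>2, \<beta>)\<close>\<close>

text \<open>For an odd exponent each even power of \<open>v * S\<close> in the binomial expansion
  comes with an odd power of \<open>u\<close>, so \<open>u\<close> divides the part without
  \<open>S\<close>. The induction multiplies by the square of the base.\<close>

lemma odd_power_real_part:
  fixes S :: complex
  assumes "S ^ 2 = of_int d"
  shows "\<exists>x y :: int. (of_int u + of_int v * S) ^ (2 * l + 1) = of_int (u * x) + of_int y * S"
proof (induction l)
  case 0
  show ?case by (intro exI[of _ 1] exI[of _ v]) simp
next
  case (Suc l)
  then obtain x y :: int where xy: "(of_int u + of_int v * S) ^ (2 * l + 1) = of_int (u * x) + of_int y * S"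
    by blast
  have sq: "(of_int u + of_int v * S) ^ 2 = of_int (u * u + v * v * d) + of_int (2 * u * v) * S"
    unfolding of_int_add of_int_mult assms[symmetric] by (simp add: algebra_simps power2_eq_square)
  have "(of_int u + of_int v * S) ^ (2 * Suc l + 1)
      = (of_int u + of_int v * S) ^ (2 * l + 1) * (of_int u + of_int v * S) ^ 2"
    by (simp flip: power_add)
  also have "\<dots> = of_int (u * (x * (u * u + v * v * d) + 2 * v * y * d))
      + of_int (y * (u * u + v * v * d) + 2 * u * u * v * x) * S"
    unfolding xy sq of_int_add of_int_mult assms[symmetric] by (simp add: algebra_simps power2_eq_square)
  finally show ?case by blast
qed

section \<open>The element \<beta> is not a proper odd power\<close>

context imaginary_sqrt_3_mod_4
begin

lemma zring_of_square:
  assumes "x \<in> K" "y \<in> \<O>" "x ^ 2 = y"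
  shows "x \<in> \<O>"
proof -
  have "algebraic_int x"
    by (rule algebraic_int_root[of y "monom 1 2"])
       (use assms algebraic_int_zring in \<open>auto simp: poly_monom degree_monom_eq\<close>)
  then show ?thesis using assms(1) algebraic_int_trace_norm zringI by blast
qed

text \<open>In coordinates the norm equation is \<open>a * a - b * b * D = 1\<close> with
  \<open>D < 0\<close>. Either \<open>b = 0\<close> and \<epsilon> is \<open>1\<close> or
  \<open>- 1\<close>, or \<open>a = 0\<close> and \<open>\<epsilon> * \<epsilon> = - 1\<close>.
  Sixth roots of unity do not arise, because the coordinates are integers.\<close>

lemma unit_power_4:
  assumes "\<epsilon> \<in> \<O>" "cmod \<epsilon> = 1"
  shows "\<epsilon> ^ 4 = 1"
proof -
  obtain a b :: int where e: "\<epsilon> = of_int a + of_int b * om" using assms(1) unfolding zring_def by blast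
  have c: "cnj \<epsilon> = of_int a - of_int b * om" unfolding e by simp
  have "\<epsilon> * cnj \<epsilon> = 1" using assms(2) complex_norm_square[of \<epsilon>] by simp
  also have "\<epsilon> * cnj \<epsilon> = of_int a * of_int a - of_int b * of_int b * om ^ 2"
    unfolding c e by (simp add: algebra_simps power2_eq_square)
  also have "\<dots> = of_int (a * a - b * b * D)" unfolding om_square by simp
  finally have 1: "a * a - b * b * D = 1" by (metis of_int_eq_1_iff)
  show ?thesis
  proof (cases "b = 0")
    case True
    then have "of_int (a * a) = (1 :: complex)" using 1 by simp
    then have "\<epsilon> * \<epsilon> = 1" unfolding e True by simp
    then have "(\<epsilon> * \<epsilon>) * (\<epsilon> * \<epsilon>) = 1" by simp
    then show ?thesis by (simp add: power4_eq_xxxx mult.assoc)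
  next
    case False
    have "b * b \<ge> 1" using False by (metis add.left_neutral int_one_le_iff_zero_less not_square_less_zero linorder_neqE_linordered_idom zero_less_mult_iff)
    then have "b * b * (- D) \<ge> 1" using neg by (metis mult_le_mono int_one_le_iff_zero_less mult_pos_pos neg_0_less_iff_less)
    then have "b * b * D \<le> - 1" by simp
    moreover have "a * a \<ge> 0" by simp
    ultimately have "a * a = 0" "b * b * D = - 1" using 1 by linarith+
    then have "\<epsilon> = of_int b * om" unfolding e by simp
    then have "\<epsilon> * \<epsilon> = of_int (b * b) * om ^ 2" by (simp add: power2_eq_square)
    also have "\<dots> = of_int (b * b * D)" unfolding om_square by simp
    finally have "\<epsilon> * \<epsilon> = - 1" unfolding \<open>b * b * D = - 1\<close> by simp
    then have "(\<epsilon> * \<epsilon>) * (\<epsilon> * \<epsilon>) = 1" by simp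
    then show ?thesis by (simp add: power4_eq_xxxx mult.assoc)
  qed
qed

lemma cmod_zring_square: "(cmod (of_int u + of_int v * om)) ^ 2 = of_int (u * u - v * v * D)"
proof -
  have "of_real ((cmod (of_int u + of_int v * om)) ^ 2) = (of_int u + of_int v * om) * (of_int u - of_int v * om)"
    unfolding complex_norm_square by simp
  also have "\<dots> = of_int u * of_int u - of_int v * of_int v * om ^ 2"
    by (simp add: algebra_simps power2_eq_square)
  also have "\<dots> = of_int (u * u - v * v * D)" unfolding om_square by simp
  finally show ?thesis by (metis of_real_eq_iff of_real_of_int_eq)
qed

text \<open>If \<beta> were \<open>\<gamma> ^ k\<close>, then \<open>2 * \<gamma>\<close> would be
  the square of an integer \<delta> whose \<open>k\<close>-th power has real part exactly
  \<open>2 ^ (k div 2)\<close>. Up to sign \<delta> has the form treated in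
  \<open>Re_odd_power_neq\<close>; \<open>h > 0\<close> ensures \<open>n > 1\<close>, and hence
  \<open>f < 0\<close> there.\<close>

lemma not_odd_power:
  assumes m: "odd m" "m > 1" and k: "odd k" "k > 1" and h: "h > 0"
    and s: "D * s ^ 2 = 1 - 2 * int m ^ (k * h)"
    and \<gamma>: "\<gamma> \<in> \<O>" and eq: "1 - of_nat m ^ (k * h) + of_int s * om = \<gamma> ^ k"
  shows False
proof -
  define n where "n = int m ^ h"
  have n: "odd n" "n > 1" using m h unfolding n_def by (simp_all add: one_less_power)
  define \<alpha> where "\<alpha> = 1 + of_int s * om"
  have somsq: "(of_int s * om) ^ 2 = 1 - 2 * of_int (n ^ k)"
  proof -
    have "(of_int s * om) ^ 2 = of_int (D * s ^ 2)" by (simp add: power_mult_distrib om_square)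
    then show ?thesis unfolding s n_def by (simp add: power_mult mult.commute)
  qed
  have eq': "\<gamma> ^ k = 1 - of_int (n ^ k) + of_int s * om"
    unfolding eq[symmetric] n_def by (simp add: power_mult mult.commute)
  have asq: "\<alpha> ^ 2 = 2 * \<gamma> ^ k"
    unfolding eq' \<alpha>_def using somsq by (simp add: power2_sum)
  have kk: "k = 2 * (k div 2) + 1" using k(1) by presburger
  have "\<alpha> \<noteq> 0"
  proof
    assume "\<alpha> = 0"
    then have "Re \<alpha> = 0" by simp
    then show False by (simp add: \<alpha>_def)
  qed
  then have g0: "\<gamma> \<noteq> 0" using asq k(2) by (auto simp: zero_power)
  \<comment> \<open>With \<open>\<alpha> ^ 2 = 2 * \<gamma> ^ k\<close> and \<open>k\<close> odd,
    dividing \<alpha> by \<open>\<gamma> ^ (k div 2)\<close> leaves a square root of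
    \<open>2 * \<gamma>\<close>.\<close>
  define \<delta> where "\<delta> = \<alpha> / \<gamma> ^ (k div 2)"
  have d2: "\<delta> ^ 2 = 2 * \<gamma>"
  proof -
    have gk: "\<gamma> ^ k = \<gamma> ^ (2 * (k div 2)) * \<gamma>" using kk by (metis power_Suc2 Suc_eq_plus1)
    have "\<delta> ^ 2 = \<alpha> ^ 2 / \<gamma> ^ (2 * (k div 2))"
      unfolding \<delta>_def power_divide by (simp add: power_mult[symmetric] mult.commute)
    also have "\<dots> = 2 * \<gamma>" unfolding asq gk using g0 by simp
    finally show ?thesis .
  qed
  have "\<delta> ^ k = \<delta> * (\<delta> ^ 2) ^ (k div 2)" using kk by (metis power_Suc power_mult Suc_eq_plus1)
  also have "\<dots> = 2 ^ (k div 2) * \<alpha>" unfolding d2 power_mult_distrib by (simp add: \<delta>_def g0)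
  finally have dk: "\<delta> ^ k = 2 ^ (k div 2) * \<alpha>" .
  have "\<alpha> \<in> \<O>" unfolding \<alpha>_def by (intro zring_add O_mult) auto
  then have "\<delta> \<in> K" unfolding \<delta>_def using \<gamma> by (intro K_divide K_power zring_K)
  moreover have "2 * \<gamma> \<in> \<O>" using \<gamma> by (intro O_mult) auto
  ultimately have "\<delta> \<in> \<O>" using d2 by (rule zring_of_square)
  then obtain u v :: int where uv: "\<delta> = of_int u + of_int v * om" unfolding zring_def by blast
  \<comment> \<open>Absolute values in \<open>asq\<close>: the norm of \<alpha> is
    \<open>1 - s * s * D = 2 * n ^ k\<close>.\<close>
  have cg: "cmod \<gamma> = of_int n"
  proof -
    have "2 * cmod \<gamma> ^ k = (cmod \<alpha>) ^ 2" using arg_cong[OF asq, of cmod] by (simp add: norm_mult norm_power)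
    also have "\<alpha> = of_int 1 + of_int s * om" unfolding \<alpha>_def by simp
    also have "(cmod (of_int 1 + of_int s * om)) ^ 2 = of_int (1 - s * s * D)"
      using cmod_zring_square[of 1 s] by simp
    also have "1 - s * s * D = 2 * n ^ k"
      using s unfolding n_def by (simp add: power_mult mult.commute power2_eq_square)
    finally have "cmod \<gamma> ^ k = of_int n ^ k" by simp
    then show ?thesis using power_eq_imp_eq_base[of "cmod \<gamma>" k "of_int n"] n(2) k(2) by simp
  qed
  have N: "u * u - v * v * D = 2 * n"
  proof -
    have "of_int (u * u - v * v * D) = (cmod \<delta>) ^ 2" unfolding uv cmod_zring_square ..
    also have "\<dots> = cmod (\<delta> ^ 2)" by (simp add: norm_power)
    also have "\<dots> = of_int (2 * n)" unfolding d2 by (simp add: norm_mult cg)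
    finally show ?thesis by linarith
  qed
  \<comment> \<open>If \<open>u\<close> were even, \<open>v\<close> would be even too, and 4 would
    divide \<open>2 * n\<close> with \<open>n\<close> odd.\<close>
  have "odd u"
  proof
    assume "even u"
    moreover have "v * v * D = u * u - 2 * n" using N by simp
    ultimately have "even (v * v * D)" by simp
    moreover have "odd D" using mod_4 by presburger
    ultimately have "even v" by simp
    then have "4 dvd v * v" using mult_dvd_mono[OF \<open>even v\<close> \<open>even v\<close>] by simp
    moreover have "4 dvd u * u" using mult_dvd_mono[OF \<open>even u\<close> \<open>even u\<close>] by simp
    ultimately have "4 dvd 2 * n" unfolding N[symmetric] by simp
    then show False using n(1) by presburger
  qed
  \<comment> \<open>The odd number \<open>u\<close> divides the real part of
    \<open>\<delta> ^ k\<close>, which is a power of 2, so \<open>u\<close> is \<open>1\<close> or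
    \<open>- 1\<close>.\<close>
  obtain x y where xy: "\<delta> ^ k = of_int (u * x) + of_int y * om"
    using kk odd_power_real_part[OF om_square, of u v "k div 2"] unfolding uv by metis
  then have "Re (\<delta> ^ k) = of_int (u * x)" by simp
  moreover have "Re (\<delta> ^ k) = 2 ^ (k div 2)"
  proof -
    have "2 ^ (k div 2) * \<alpha> = of_real (2 ^ (k div 2)) * \<alpha>" by simp
    then show ?thesis unfolding dk by (simp add: \<alpha>_def)
  qed
  ultimately have re: "Re (\<delta> ^ k) = 2 ^ (k div 2)" and "of_int (u * x) = (of_int (2 ^ (k div 2)) :: real)"
    by simp_all
  then have "u * x = 2 ^ (k div 2)" by (simp only: of_int_eq_iff)
  then have "u dvd 2 ^ (k div 2)" by (metis dvd_triv_left)
  moreover have "coprime u (2 ^ (k div 2))" using \<open>odd u\<close> by simp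
  ultimately have "is_unit u" using coprime_common_divisor[of u "2 ^ (k div 2)" u] by simp
  then have u1: "u * u = 1" by (metis abs_mult_self_eq mult_1 zdvd1_eq)
  \<comment> \<open>Multiplying \<delta> by the sign \<open>u\<close> normalises it to
    \<open>1 + S\<close>. The choice of \<open>f\<close> gives
    \<open>S ^ 2 = 1 - 2 * n = 4 * f - 1\<close>.\<close>
  define S where "S = of_int (u * v) * om"
  define f where "f = (1 - n) div 2"
  have f: "2 * f = 1 - n" "f < 0" using n unfolding f_def by presburger+
  have "S ^ 2 = of_int (v * v * D)"
    unfolding S_def power_mult_distrib om_square using u1 by (simp add: power2_eq_square algebra_simps flip: of_int_mult)
  also have "v * v * D = 4 * f - 1" using N u1 f(1) by simp
  finally have S: "S ^ 2 = of_int (4 * f - 1)" .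
  have "1 + S = of_int u * \<delta>" unfolding uv S_def using u1 by (simp add: algebra_simps flip: of_int_mult)
  then have "(1 + S) ^ k = of_real (of_int u ^ k) * \<delta> ^ k" by (simp add: power_mult_distrib)
  then have "Re ((1 + S) ^ k) = of_int u ^ k * 2 ^ (k div 2)" using re by (simp only: Re_of_real_mult)
  moreover have "\<bar>of_int u\<bar> = (1::real)" using \<open>is_unit u\<close> by (auto simp: zdvd1_eq)
  ultimately have "\<bar>Re ((1 + S) ^ k)\<bar> = 2 ^ (k div 2)" by (simp add: abs_mult power_abs)
  then show False using Re_odd_power_neq[OF S _ f(2) k] unfolding S_def by simp
qed

end

section \<open>The ideal class group and the order of a class\<close>

context imaginary_sqrt_3_mod_4
begin

abbreviation "\<G> \<equiv> fractional_ideal_group K"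
abbreviation "\<P> \<equiv> principal_fractional_ideals K"

lemma fractional_ideal_group_simps [simp]:
  "carrier \<G> = {I. frac_ideal I}" "I \<otimes>\<^bsub>\<G>\<^esub> J = I \<bullet> J" "\<one>\<^bsub>\<G>\<^esub> = \<O>"
  by (simp_all add: fractional_ideal_group_def fractional_ideal_iff ring_of_integers_carrier)

lemma principal_iff: "I \<in> \<P> \<longleftrightarrow> (\<exists>a \<in> K. a \<noteq> 0 \<and> I = (*) a ` \<O>)"
  by (auto simp: principal_fractional_ideals_def ring_of_integers_carrier)

lemma comm_group_fractional_ideals: "comm_group \<G>"
proof (rule comm_groupI)
  fix I assume "I \<in> carrier \<G>"
  then have "frac_ideal I" by simp
  then obtain J where "frac_ideal J" "I \<bullet> J = \<O>" by (rule frac_inverse)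
  then show "\<exists>J \<in> carrier \<G>. J \<otimes>\<^bsub>\<G>\<^esub> I = \<one>\<^bsub>\<G>\<^esub>"
    by (intro bexI[of _ J]) (simp_all add: mprod_commute[of J I])
next
  fix I J :: "complex set" show "I \<otimes>\<^bsub>\<G>\<^esub> J = J \<otimes>\<^bsub>\<G>\<^esub> I" by (simp add: mprod_commute[of I J])
next
  fix I J assume "I \<in> carrier \<G>" "J \<in> carrier \<G>"
  then show "I \<otimes>\<^bsub>\<G>\<^esub> J \<in> carrier \<G>" by (simp add: frac_mprod)
next
  show "\<one>\<^bsub>\<G>\<^esub> \<in> carrier \<G>" by (simp add: frac_O)
next
  fix I J L :: "complex set"
  show "(I \<otimes>\<^bsub>\<G>\<^esub> J) \<otimes>\<^bsub>\<G>\<^esub> L = I \<otimes>\<^bsub>\<G>\<^esub> (J \<otimes>\<^bsub>\<G>\<^esub> L)"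
    unfolding fractional_ideal_group_simps by (rule mprod_assoc)
next
  fix I assume "I \<in> carrier \<G>"
  then show "\<one>\<^bsub>\<G>\<^esub> \<otimes>\<^bsub>\<G>\<^esub> I = I" by (simp add: mprod_O)
qed

lemma principal_mprod: "((*) a ` \<O>) \<bullet> ((*) b ` \<O>) = (*) (a * b) ` \<O>"
proof -
  have "((*) a ` \<O>) \<bullet> ((*) b ` \<O>) = (*) a ` (((*) b ` \<O>) \<bullet> \<O>)"
    unfolding mprod_scale[of a] mprod_commute[of \<O> "(*) b ` \<O>"] ..
  also have "\<dots> = (*) (a * b) ` \<O>"
    unfolding mprod_scale mprod_O[OF frac_O] image_image by (simp add: mult.assoc)
  finally show ?thesis .
qed

lemma frac_principal: "a \<in> K \<Longrightarrow> a \<noteq> 0 \<Longrightarrow> frac_ideal ((*) a ` \<O>)"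
  using frac_scale[OF frac_O] .

lemma subgroup_principal: "subgroup \<P> \<G>"
proof -
  interpret comm_group \<G> by (rule comm_group_fractional_ideals)
  show ?thesis
  proof (rule subgroupI)
    show "\<P> \<subseteq> carrier \<G>" using frac_principal by (auto simp: principal_iff)
    have "(*) 1 ` \<O> \<in> \<P>" unfolding principal_iff by (rule bexI[of _ 1]) (simp_all add: K_rat)
    then show "\<P> \<noteq> {}" by blast
  next
    fix I assume "I \<in> \<P>"
    then obtain a where a: "a \<in> K" "a \<noteq> 0" "I = (*) a ` \<O>" unfolding principal_iff by auto
    have i: "inverse a \<in> K" using a(1) by (rule K_inverse)
    have "inv\<^bsub>\<G>\<^esub> I = (*) (inverse a) ` \<O>"
      by (rule inv_equality)
         (use a i in \<open>simp_all add: principal_mprod frac_principal\<close>)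
    then show "inv\<^bsub>\<G>\<^esub> I \<in> \<P>" using a i unfolding principal_iff by (intro bexI[of _ "inverse a"]) simp_all
  next
    fix I J assume "I \<in> \<P>" "J \<in> \<P>"
    then obtain a b where "a \<in> K" "a \<noteq> 0" "I = (*) a ` \<O>" "b \<in> K" "b \<noteq> 0" "J = (*) b ` \<O>"
      unfolding principal_iff by auto
    then show "I \<otimes>\<^bsub>\<G>\<^esub> J \<in> \<P>"
      unfolding principal_iff by (intro bexI[of _ "a * b"]) (simp_all add: principal_mprod K_mult)
  qed
qed

lemma group_ideal_class_group: "group (ideal_class_group K)"
  unfolding ideal_class_group_def
  using comm_group.subgroup_imp_normal[OF comm_group_fractional_ideals subgroup_principal]
  by (rule normal.factorgroup_is_group)

text \<open>The order divides \<open>t\<close> as soon as the \<open>t\<close>-th power is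
  principal, so testing the proper divisors of \<open>t\<close> decides that it equals
  \<open>t\<close>.\<close>

lemma ord_ideal_class:
  assumes J: "frac_ideal J" and t: "t > 0" "J [^]\<^bsub>\<G>\<^esub> t \<in> \<P>"
    and min: "\<And>h. 0 < h \<Longrightarrow> h < t \<Longrightarrow> h dvd t \<Longrightarrow> J [^]\<^bsub>\<G>\<^esub> h \<notin> \<P>"
  shows "\<P> #>\<^bsub>\<G>\<^esub> J \<in> carrier (ideal_class_group K)"
    and "group.ord (ideal_class_group K) (\<P> #>\<^bsub>\<G>\<^esub> J) = t"
proof -
  interpret comm_group \<G> by (rule comm_group_fractional_ideals)
  interpret N: normal \<P> \<G> using subgroup_imp_normal[OF subgroup_principal] .
  interpret C: group "ideal_class_group K" by (rule group_ideal_class_group)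
  have Jc: "J \<in> carrier \<G>" using J by simp
  show c: "\<P> #>\<^bsub>\<G>\<^esub> J \<in> carrier (ideal_class_group K)"
    unfolding ideal_class_group_def carrier_FactGroup using Jc by (rule imageI)
  have pow: "(\<P> #>\<^bsub>\<G>\<^esub> J) [^]\<^bsub>ideal_class_group K\<^esub> n = \<one>\<^bsub>ideal_class_group K\<^esub>
     \<longleftrightarrow> J [^]\<^bsub>\<G>\<^esub> n \<in> \<P>" for n :: nat
  proof -
    have Jn: "J [^]\<^bsub>\<G>\<^esub> n \<in> carrier \<G>" using Jc by (rule nat_pow_closed)
    have "(\<P> #>\<^bsub>\<G>\<^esub> J) [^]\<^bsub>ideal_class_group K\<^esub> n = \<P> #>\<^bsub>\<G>\<^esub> (J [^]\<^bsub>\<G>\<^esub> n)"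
      unfolding ideal_class_group_def using Jc by (rule N.FactGroup_pow)
    moreover have "\<P> #>\<^bsub>\<G>\<^esub> (J [^]\<^bsub>\<G>\<^esub> n) = \<P> \<longleftrightarrow> J [^]\<^bsub>\<G>\<^esub> n \<in> \<P>"
      using coset_join1[OF _ Jn subgroup_principal] coset_join2[OF Jn subgroup_principal] by metis
    ultimately show ?thesis by (simp add: ideal_class_group_def)
  qed
  have dvd: "C.ord (\<P> #>\<^bsub>\<G>\<^esub> J) dvd t" using C.pow_eq_id[OF c, of t] pow t(2) by blast
  then have pos: "C.ord (\<P> #>\<^bsub>\<G>\<^esub> J) > 0" using t(1) by (metis dvd_0_left_iff gr0I)
  have "J [^]\<^bsub>\<G>\<^esub> C.ord (\<P> #>\<^bsub>\<G>\<^esub> J) \<in> \<P>" using C.pow_ord_eq_1[OF c] pow by blast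
  then have "\<not> C.ord (\<P> #>\<^bsub>\<G>\<^esub> J) < t" using min[OF pos _ dvd] by blast
  then show "C.ord (\<P> #>\<^bsub>\<G>\<^esub> J) = t" using dvd_imp_le[OF dvd t(1)] by linarith
qed

lemma cnj_pow: "cnj ` (J [^]\<^bsub>\<G>\<^esub> (n :: nat)) = (cnj ` J) [^]\<^bsub>\<G>\<^esub> n"
proof -
  interpret comm_group \<G> by (rule comm_group_fractional_ideals)
  have O: "cnj ` \<O> = \<O>"
  proof
    show "cnj ` \<O> \<subseteq> \<O>" by blast
    show "\<O> \<subseteq> cnj ` \<O>" using zring_cnj by (metis complex_cnj_cnj imageI subsetI)
  qed
  show ?thesis by (induction n) (simp_all add: O cnj_mprod)
qed

lemma principal_pow: "((*) a ` \<O>) [^]\<^bsub>\<G>\<^esub> (n :: nat) = (*) (a ^ n) ` \<O>"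
proof -
  interpret comm_group \<G> by (rule comm_group_fractional_ideals)
  show ?thesis by (induction n) (simp, simp only: nat_pow_Suc fractional_ideal_group_simps principal_mprod power_Suc2)
qed

lemma pow_subset_O: 
  assumes "J \<subseteq> \<O>" shows "J [^]\<^bsub>\<G>\<^esub> (n :: nat) \<subseteq> \<O>"
proof -
  interpret comm_group \<G> by (rule comm_group_fractional_ideals)
  show ?thesis
  proof (induction n)
    case (Suc n)
    then show ?case using mprod_least[of "J [^]\<^bsub>\<G>\<^esub> n" J \<O>] assms by (auto intro: O_mult)
  qed simp
qed

text \<open>Modulo \<open>y\<close> only the power of \<open>x\<close> survives: every other term of
  the expanded product contains a factor \<open>y\<close>.\<close>

lemma gen_pow_subset:
  assumes "x \<in> \<O>" "y \<in> \<O>"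
  shows "gen x y [^]\<^bsub>\<G>\<^esub> (n :: nat) \<subseteq> gen (x ^ n) y"
proof -
  interpret comm_group \<G> by (rule comm_group_fractional_ideals)
  show ?thesis
  proof (induction n)
    case 0
    show ?case
    proof
      fix a assume "a \<in> gen x y [^]\<^bsub>\<G>\<^esub> (0 :: nat)"
      then have "a \<in> \<O>" by simp
      then show "a \<in> gen (x ^ 0) y" using gen_mult[OF _ gen_mem(1), of a 1 y] by simp
    qed
  next
    case (Suc n)
    have "(gen x y [^]\<^bsub>\<G>\<^esub> n) \<bullet> gen x y \<subseteq> gen (x ^ Suc n) y"
    proof (rule mprod_least)
      fix i j assume "i \<in> gen x y [^]\<^bsub>\<G>\<^esub> n" "j \<in> gen x y"
      then obtain a b c d where *: "i = a * x ^ n + b * y" "j = c * x + d * y"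
        "a \<in> \<O>" "b \<in> \<O>" "c \<in> \<O>" "d \<in> \<O>" using Suc unfolding gen_def by blast
      have "i * j = (a * c) * x ^ Suc n + (a * x ^ n * d + b * c * x + b * d * y) * y"
        unfolding * by (simp add: algebra_simps)
      moreover have "a * c \<in> \<O>" "a * x ^ n * d + b * c * x + b * d * y \<in> \<O>"
        using * assms by (auto intro!: zring_add O_mult zring_power[OF om_square])
      ultimately show "i * j \<in> gen (x ^ Suc n) y" unfolding gen_def by blast
    qed (rule gen_add)
    then show ?case by simp
  qed
qed

text \<open>The second generator matters only modulo \<open>n\<close>, so at most
  \<open>n ^ 2\<close> choices of residues for its two coordinates remain.\<close>

lemma finite_gen_of_int:
  assumes "n > 0"
  shows "finite {gen (of_int n) z | z. z \<in> \<O>}"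
proof (rule finite_subset)
  show "finite ((\<lambda>(a, b). gen (of_int n) (of_int a + of_int b * om)) ` ({0..<n} \<times> {0..<n}))" by simp
  show "{gen (of_int n) z | z. z \<in> \<O>}
      \<subseteq> (\<lambda>(a, b). gen (of_int n) (of_int a + of_int b * om)) ` ({0..<n} \<times> {0..<n})"
  proof clarify
    fix z assume "z \<in> \<O>"
    then obtain a b :: int where z: "z = of_int a + of_int b * om" unfolding zring_def by blast
    define z' where "z' = of_int (a mod n) + of_int (b mod n) * om"
    define w where "w = of_int (a div n) + of_int (b div n) * om"
    have w: "w \<in> \<O>" unfolding w_def zring_def by blast
    have dm: "(of_int c :: complex) = of_int n * of_int (c div n) + of_int (c mod n)" for c
      by (metis of_int_add of_int_mult mult_div_mod_eq)
    have zz: "z = w * of_int n + z'"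
      unfolding z w_def z'_def dm[of a] dm[of b] by (simp add: algebra_simps)
    have "gen (of_int n) z = gen (of_int n) z'"
    proof
      show "gen (of_int n) z \<subseteq> gen (of_int n) z'"
        by (rule gen_least)
           (auto simp: zz intro: gen_add gen_mult w gen_mem)
      have "z' = (- w) * of_int n + z" unfolding zz by simp
      then show "gen (of_int n) z' \<subseteq> gen (of_int n) z"
        by (intro gen_least) (auto intro: gen_add gen_mult zring_uminus w gen_mem simp del: mult_minus_left)
    qed
    then show "gen (of_int n) z \<in> (\<lambda>(a, b). gen (of_int n) (of_int a + of_int b * om)) ` ({0..<n} \<times> {0..<n})"
      unfolding z'_def using assms by (intro image_eqI[of _ _ "(a mod n, b mod n)"]) auto
  qed
qed

text \<open>Write \<open>M\<close> for the square of \<open>m\<close>, so that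
  \<open>\<beta> * cnj \<beta> = M ^ t\<close>. Then \<open>J ^ t\<close> lies in the ideal of
  \<beta>, because \<open>M ^ t\<close> does. Conversely \<open>J\<close> times its conjugate is
  generated by \<open>M\<close>, so \<open>J ^ t\<close> times its conjugate is generated by
  \<open>M ^ t\<close>, which leaves no room for a proper inclusion.\<close>

lemma ideal_pow_eq_principal:
  fixes m t :: nat and s :: int
  defines "\<beta> \<equiv> 1 - of_nat m ^ t + of_int s * om"
  assumes m: "odd m" "m > 1" and t: "t > 0" and s: "D * s ^ 2 = 1 - 2 * int m ^ t"
  shows "frac_ideal (gen (of_int (int m ^ 2)) \<beta>)" "\<beta> \<in> \<O>" "\<beta> \<noteq> 0"
    and "gen (of_int (int m ^ 2)) \<beta> [^]\<^bsub>\<G>\<^esub> t = (*) \<beta> ` \<O>"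
proof -
  interpret comm_group \<G> by (rule comm_group_fractional_ideals)
  define M :: complex where "M = of_int (int m ^ 2)"
  define J where "J = gen M \<beta>"
  show bO: "\<beta> \<in> \<O>"
    unfolding \<beta>_def by (intro zring_add zring_diff O_mult zring_power[OF om_square]) auto
  have MO: "M \<in> \<O>" unfolding M_def by blast
  have M0: "M \<noteq> 0" unfolding M_def using m by simp
  have J: "frac_ideal J" unfolding J_def using MO bO M0 by (rule frac_gen)
  then show "frac_ideal (gen (of_int (int m ^ 2)) \<beta>)" unfolding J_def M_def .
  have cb: "cnj \<beta> = 1 - of_nat m ^ t - of_int s * om" unfolding \<beta>_def by simp
  have norm: "\<beta> * cnj \<beta> = M ^ t"
  proof -
    have "\<beta> * cnj \<beta> = (1 - of_nat m ^ t) ^ 2 - of_int s ^ 2 * om ^ 2"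
      unfolding cb unfolding \<beta>_def by (simp add: algebra_simps power2_eq_square)
    also have "of_int s ^ 2 * om ^ 2 = of_int (D * s ^ 2)" by (simp add: om_square)
    also have "(1 - of_nat m ^ t) ^ 2 - of_int (D * s ^ 2) = (of_nat m ^ t :: complex) ^ 2"
      unfolding s by (simp add: power2_eq_square algebra_simps)
    also have "\<dots> = M ^ t" unfolding M_def by (simp add: power_mult[symmetric] mult.commute)
    finally show ?thesis .
  qed
  then show b0: "\<beta> \<noteq> 0" using M0 by auto
  have cM: "cnj M = M" unfolding M_def by simp
  have JJ: "J \<bullet> (cnj ` J) = (*) M ` \<O>"
  proof
    have fM: "frac_ideal ((*) M ` \<O>)" using MO M0 by (intro frac_principal zring_K)
    \<comment> \<open>As \<open>t > 0\<close>, the norm \<open>M ^ t\<close> of \<beta> contains a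
      factor \<open>M\<close> that can be split off.\<close>
    obtain t' where t': "t = Suc t'" using t by (metis gr0_implies_Suc)
    show "J \<bullet> (cnj ` J) \<subseteq> (*) M ` \<O>"
    proof (rule mprod_least)
      fix i j assume "i \<in> J" "j \<in> cnj ` J"
      then obtain a b c d where *: "i = a * M + b * \<beta>" "j = cnj (c * M + d * \<beta>)"
        "a \<in> \<O>" "b \<in> \<O>" "c \<in> \<O>" "d \<in> \<O>" unfolding J_def gen_def by blast
      have "i * j = a * cnj c * M * M + a * cnj d * M * cnj \<beta> + b * cnj c * M * \<beta> + b * cnj d * (\<beta> * cnj \<beta>)"
        unfolding * by (simp add: algebra_simps cM)
      also have "\<dots> = M * (a * cnj c * M + a * cnj d * cnj \<beta> + b * cnj c * \<beta> + b * cnj d * M ^ t')"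
        unfolding norm t' by (simp add: algebra_simps)
      finally show "i * j \<in> (*) M ` \<O>"
        using * MO bO by (auto intro!: imageI zring_add O_mult zring_cnj zring_power[OF om_square])
    qed (rule fracD(3)[OF fM])
    have fP: "frac_ideal (J \<bullet> (cnj ` J))" using J by (intro frac_mprod frac_cnj)
    have mem: "u * cnj v \<in> J \<bullet> (cnj ` J)" if "u \<in> J" "v \<in> J" for u v
      using that by (intro mprod_mult imageI)
    have gens: "M \<in> J" "\<beta> \<in> J" unfolding J_def by (rule gen_mem)+
    \<comment> \<open>The second number is the trace of \<beta>; this coprimality expresses that
      \<beta> and its conjugate are coprime. The factor 2 is where \<open>m\<close> must be odd.
      Bezout then writes \<open>M\<close> as a combination of \<open>M * M\<close> and
      \<open>M\<close> times the trace.\<close>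
    have "coprime (int m ^ 2) (2 * (1 - int m ^ t))"
    proof -
      have "coprime (int m) 2" using m(1) by simp
      moreover have "coprime (int m) (1 - int m ^ t)"
        unfolding t' by (rule coprimeI) (metis dvd_add_right_iff dvd_mult2 diff_add_cancel add.commute power_Suc)
      ultimately show ?thesis by (simp only: coprime_mult_right_iff coprime_power_left_iff) simp
    qed
    then obtain p q where pq: "p * int m ^ 2 + q * (2 * (1 - int m ^ t)) = 1"
      using bezout_int[of "int m ^ 2" "2 * (1 - int m ^ t)"] by (auto simp: coprime_iff_gcd_eq_1)
    have "of_int p * (M * cnj M) + of_int q * (M * cnj \<beta> + \<beta> * cnj M) \<in> J \<bullet> (cnj ` J)"
      by (intro fracD(3)[OF fP] fracD(4)[OF fP zring_of_int] mem gens)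
    also have "of_int p * (M * cnj M) + of_int q * (M * cnj \<beta> + \<beta> * cnj M)
        = M * of_int (p * int m ^ 2 + q * (2 * (1 - int m ^ t)))"
      unfolding cM cb unfolding \<beta>_def M_def by (simp add: algebra_simps)
    finally have "M \<in> J \<bullet> (cnj ` J)" unfolding pq by simp
    then show "(*) M ` \<O> \<subseteq> J \<bullet> (cnj ` J)"
      using fracD(4)[OF fP] by (auto simp: mult.commute)
  qed
  define Jt where "Jt = J [^]\<^bsub>\<G>\<^esub> t"
  have fJt: "frac_ideal Jt" unfolding Jt_def using nat_pow_closed[of J t] J by simp
  have sub: "Jt \<subseteq> (*) \<beta> ` \<O>"
  proof -
    have "Jt \<subseteq> gen (M ^ t) \<beta>" unfolding Jt_def J_def using MO bO by (rule gen_pow_subset)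
    also have "\<dots> \<subseteq> (*) \<beta> ` \<O>"
    proof (rule gen_least)
      show "M ^ t \<in> (*) \<beta> ` \<O>" unfolding norm[symmetric] using bO by blast
      show "\<beta> \<in> (*) \<beta> ` \<O>" by (rule image_eqI[of _ _ 1]) auto
    qed (use fracD(3,4)[OF frac_principal[OF zring_K[OF bO] b0]] in blast)+
    finally show ?thesis .
  qed
  have prod: "Jt \<bullet> (cnj ` Jt) = (*) (M ^ t) ` \<O>"
  proof -
    have cJ: "cnj ` J \<in> carrier \<G>" "J \<in> carrier \<G>" using J frac_cnj by simp_all
    have "Jt \<bullet> (cnj ` Jt) = (J \<otimes>\<^bsub>\<G>\<^esub> (cnj ` J)) [^]\<^bsub>\<G>\<^esub> t"
      unfolding Jt_def cnj_pow using nat_pow_distrib[OF cJ(2,1)] by simp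
    then show ?thesis unfolding fractional_ideal_group_simps JJ principal_pow .
  qed
  \<comment> \<open>The conjugate of \<open>J ^ t\<close> lies in the ideal of
    \<open>cnj \<beta>\<close>, so \<open>M ^ t = \<beta> * cnj \<beta>\<close> lies in
    \<open>cnj \<beta>\<close> times \<open>J ^ t\<close>; cancel
    \<open>cnj \<beta>\<close>.\<close>
  have "\<beta> \<in> Jt"
  proof -
    have "cnj ` Jt \<subseteq> (*) (cnj \<beta>) ` \<O>" using sub by (force intro: zring_cnj)
    then have "Jt \<bullet> (cnj ` Jt) \<subseteq> Jt \<bullet> ((*) (cnj \<beta>) ` \<O>)" by (intro mprod_mono order_refl)
    also have "\<dots> = (*) (cnj \<beta>) ` Jt"
      unfolding mprod_commute[of Jt] mprod_scale mprod_O[OF fJt] ..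
    finally have "M ^ t \<in> (*) (cnj \<beta>) ` Jt" unfolding prod by (force simp: image_iff)
    then obtain w where "w \<in> Jt" "\<beta> * cnj \<beta> = cnj \<beta> * w" unfolding norm[symmetric] by auto
    then show ?thesis using b0 by simp
  qed
  then have "(*) \<beta> ` \<O> \<subseteq> Jt" using fracD(4)[OF fJt] by (auto simp: mult.commute)
  then show "gen (of_int (int m ^ 2)) \<beta> [^]\<^bsub>\<G>\<^esub> t = (*) \<beta> ` \<O>"
    using sub unfolding Jt_def J_def M_def by blast
qed

text \<open>A smaller order \<open>h\<close> would make \<beta> a unit times a \<open>k\<close>-th
  power with \<open>k = t div h\<close> odd, and the unit can be absorbed, contradicting
  \<open>not_odd_power\<close>. The ideal is named in the conclusion, not just its class, so that
  ideals of this shape can be counted later.\<close>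

lemma exists_ideal_class_of_order:
  fixes m t :: nat and s :: int
  assumes m: "odd m" "m > 1" and t: "odd t" and s: "D * s ^ 2 = 1 - 2 * int m ^ t"
  obtains z where "z \<in> \<O>"
    and "\<P> #>\<^bsub>\<G>\<^esub> gen (of_int (int m ^ 2)) z \<in> carrier (ideal_class_group K)"
    and "group.ord (ideal_class_group K) (\<P> #>\<^bsub>\<G>\<^esub> gen (of_int (int m ^ 2)) z) = t"
proof -
  interpret comm_group \<G> by (rule comm_group_fractional_ideals)
  define \<beta> where "\<beta> = 1 - of_nat m ^ t + of_int s * om"
  define J where "J = gen (of_int (int m ^ 2)) \<beta>"
  have t0: "t > 0" using t by (rule odd_pos)
  note J = ideal_pow_eq_principal[OF m t0 s, folded \<beta>_def, folded J_def]
  have JO: "J \<subseteq> \<O>" unfolding J_def by (rule gen_least[OF zring_of_int J(2) zring_add O_mult])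
  have P: "J [^]\<^bsub>\<G>\<^esub> t \<in> \<P>" unfolding J(4) principal_iff using J(2,3) zring_K by blast
  have min: "J [^]\<^bsub>\<G>\<^esub> h \<notin> \<P>" if h: "0 < h" "h < t" "h dvd t" for h
  proof
    assume "J [^]\<^bsub>\<G>\<^esub> h \<in> \<P>"
    then obtain \<gamma> where \<gamma>: "\<gamma> \<in> K" "\<gamma> \<noteq> 0" "J [^]\<^bsub>\<G>\<^esub> h = (*) \<gamma> ` \<O>" unfolding principal_iff by auto
    obtain k where k: "t = k * h" using h(3) by (metis dvdE mult.commute)
    have "odd k" using k t by simp
    moreover have "k \<noteq> 1" using k h(2) by auto
    ultimately have k1: "odd k" "k > 1" using odd_pos[of k] by simp_all
    have "1 \<in> \<O>" by simp
    then have "\<gamma> * 1 \<in> J [^]\<^bsub>\<G>\<^esub> h" unfolding \<gamma>(3) by (rule imageI)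
    then have gO: "\<gamma> \<in> \<O>" using pow_subset_O[OF JO, of h] by auto
    have "(*) \<beta> ` \<O> = (J [^]\<^bsub>\<G>\<^esub> h) [^]\<^bsub>\<G>\<^esub> k"
      using J(1,4) nat_pow_pow[of J h k] by (simp add: k mult.commute)
    also have "\<dots> = (*) (\<gamma> ^ k) ` \<O>" unfolding \<gamma>(3) principal_pow ..
    finally have eq: "(*) \<beta> ` \<O> = (*) (\<gamma> ^ k) ` \<O>" .
    have "\<beta> * 1 \<in> (*) (\<gamma> ^ k) ` \<O>" unfolding eq[symmetric] using \<open>1 \<in> \<O>\<close> by (rule imageI)
    then obtain \<epsilon> where e: "\<epsilon> \<in> \<O>" "\<beta> = \<gamma> ^ k * \<epsilon>" by auto
    have "\<gamma> ^ k * 1 \<in> (*) \<beta> ` \<O>" unfolding eq using \<open>1 \<in> \<O>\<close> by (rule imageI)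
    then obtain \<epsilon>' where e': "\<epsilon>' \<in> \<O>" "\<gamma> ^ k = \<beta> * \<epsilon>'" by auto
    have "\<gamma> ^ k \<noteq> 0" using \<gamma>(2) by simp
    then have ee: "\<epsilon> * \<epsilon>' = 1" using e(2) e'(2) by (metis mult.assoc mult_cancel_left1)
    obtain n where n: "\<epsilon> * cnj \<epsilon> = of_int n" using e(1) by (rule zring_norm)
    obtain n' where n': "\<epsilon>' * cnj \<epsilon>' = of_int n'" using e'(1) by (rule zring_norm)
    have "of_int (n * n') = (\<epsilon> * \<epsilon>') * cnj (\<epsilon> * \<epsilon>')"
      unfolding of_int_mult n[symmetric] n'[symmetric] by simp
    also have "\<dots> = 1" unfolding ee by simp
    finally have "n * n' = 1" by (metis of_int_eq_1_iff)
    moreover have "of_int n = (cmod \<epsilon>) ^ 2" using n complex_norm_square[of \<epsilon>] by (metis of_real_eq_iff of_real_of_int_eq)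
    then have "n \<ge> 0" by (metis of_int_0_le_iff zero_le_power2)
    ultimately have "n = 1" by (auto simp: zmult_eq_1_iff)
    then have "cmod \<epsilon> = 1" using \<open>of_int n = (cmod \<epsilon>) ^ 2\<close> by (metis of_int_1 norm_ge_zero power2_eq_1_iff abs_of_nonneg abs_minus_cancel abs_one)
    then have e4: "\<epsilon> ^ 4 = 1" using e(1) by (intro unit_power_4)
    \<comment> \<open>The square of the odd number \<open>k\<close> is 1 modulo 4, so the unit is
      the \<open>k\<close>-th power of \<open>\<epsilon> ^ k\<close> and can be moved into
      \<gamma>.\<close>
    have "\<epsilon> ^ (k * k) = \<epsilon>"
    proof -
      obtain l where l: "k = 2 * l + 1" using k1(1) by (rule oddE)
      have "k * k = 4 * (l * l + l) + 1" unfolding l by (simp add: algebra_simps)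
      then show ?thesis by (simp only: power_add power_mult e4) simp
    qed
    then have "\<beta> = (\<epsilon> ^ k * \<gamma>) ^ k" unfolding e(2) power_mult_distrib by (simp add: power_mult)
    moreover have "\<epsilon> ^ k * \<gamma> \<in> \<O>" using e(1) gO by (intro O_mult zring_power[OF om_square])
    ultimately show False
      using not_odd_power[OF m k1 h(1), of s "\<epsilon> ^ k * \<gamma>"] s unfolding \<beta>_def k by simp
  qed
  show ?thesis
    using that[of \<beta>] J(2) ord_ideal_class[OF J(1) t0 P min] unfolding J_def by blast
qed

end

subsection \<open>Families of fields\<close>

text \<open>For odd \<open>m\<close> the number \<open>1 - 2 * m ^ t\<close> is 3 modulo 4. Its
  square part is odd, and odd squares are 1 modulo 4, so the square-free part keeps the
  residue.\<close>

lemma squarefree_kernel: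
  fixes m t :: nat
  assumes m: "odd m" "m > 1"  and t: "t > 0"
  obtains D s where "imaginary_sqrt_3_mod_4 D" "s \<noteq> 0" "D * s ^ 2 = 1 - 2 * int m ^ t"
proof -
  define d where "d = 1 - 2 * int m ^ t"
  have d4: "d mod 4 = 3"
  proof -
    have "odd (int m ^ t)" using m by simp
    then obtain l where "int m ^ t = 2 * l + 1" by (rule oddE)
    then show ?thesis unfolding d_def by presburger
  qed
  have "int m ^ t > 0" using m by simp
  then have "d < 0" unfolding d_def by linarith
  define D s where "D = squarefree_part d" and "s = square_part d"
  have eq: "D * s ^ 2 = d" unfolding D_def s_def using squarefree_decompose[of d] by simp
  have s0: "s \<noteq> 0" using eq \<open>d < 0\<close> by auto
  then have "s ^ 2 > 0" by simp
  then have "D < 0" using eq \<open>d < 0\<close> by (metis mult_nonneg_nonneg not_less less_imp_le)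
  moreover have "squarefree D" unfolding D_def using \<open>d < 0\<close> by simp
  moreover have "D mod 4 = 3"
  proof -
    have "odd d" using d4 by presburger
    then have "odd s" unfolding eq[symmetric] by simp
    then obtain l where "s = 2 * l + 1" by (rule oddE)
    then have "d = D + 4 * (D * (l ^ 2 + l))" unfolding eq[symmetric] by (simp add: power2_eq_square algebra_simps)
    then show ?thesis using d4 by presburger
  qed
  ultimately have "imaginary_sqrt_3_mod_4 D"
    by (intro imaginary_sqrt_3_mod_4.intro imaginary_sqrt.intro imaginary_sqrt_3_mod_4_axioms.intro)
  then show ?thesis using that s0 eq unfolding d_def by blast
qed

context imaginary_sqrt_3_mod_4
begin

text \<open>The root \<open>csqrt d\<close> is an algebraic integer of the field with real part 0,
  hence an integer multiple of \<open>om\<close>; square this relation.\<close>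

lemma square_multiple_if_rat_adjoin_sqrt_eq:
  assumes "d < 0" "rat_adjoin_sqrt d = rat_adjoin_sqrt D"
  obtains s where "D * s ^ 2 = d"
proof -
  have "csqrt (of_int d) \<in> generate_field complex_field {csqrt (of_int d)}"
    by (rule generate_field.incl) simp
  then have "csqrt (of_int d) \<in> K"
    using assms(2) rat_adjoin_sqrt_eq unfolding rat_adjoin_sqrt_def by simp
  moreover have "algebraic_int (csqrt (of_int d))" by (intro algebraic_int_csqrt int_imp_algebraic_int) simp
  ultimately have "csqrt (of_int d) \<in> \<O>" using zringI algebraic_int_trace_norm by blast
  then obtain a b :: int where ab: "csqrt (of_int d) = of_int a + of_int b * om" unfolding zring_def by blast
  have "Re (csqrt (of_int d)) = 0" using assms(1) by simp
  then have "a = 0" unfolding ab by simp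
  then have "of_int (D * b ^ 2) = csqrt (of_int d) ^ 2"
    unfolding ab by (simp add: power_mult_distrib om_square)
  then have "of_int (D * b ^ 2) = (of_int d :: complex)" by simp
  then have "D * b ^ 2 = d" by (simp only: of_int_eq_iff)
  then show ?thesis by (rule that)
qed

text \<open>Each such \<open>t\<close> is the order of the class of some
  \<open>gen (m ^ 2) z\<close>, and for fixed \<open>m\<close> there are only finitely many ideals
  of this shape.\<close>

lemma finite_exponents:
  fixes m :: nat
  assumes "odd m" "m > 1"
  shows "finite {t. odd t \<and> (\<exists>s. D * s ^ 2 = 1 - 2 * int m ^ t)}"
proof (rule finite_subset)
  let ?f = "\<lambda>I. group.ord (ideal_class_group K) (\<P> #>\<^bsub>\<G>\<^esub> I)"
  let ?A = "{gen (of_int (int m ^ 2)) z | z. z \<in> \<O>}"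
  show "finite (?f ` ?A)" using assms by (intro finite_imageI finite_gen_of_int) simp
  show "{t. odd t \<and> (\<exists>s. D * s ^ 2 = 1 - 2 * int m ^ t)} \<subseteq> ?f ` ?A"
  proof clarify
    fix t s assume "odd t" "D * s ^ 2 = 1 - 2 * int m ^ t"
    from exists_ideal_class_of_order[OF assms this]
    obtain z where "z \<in> \<O>" "?f (gen (of_int (int m ^ 2)) z) = t" by blast
    then show "t \<in> ?f ` ?A" by (intro image_eqI[of _ _ "gen (of_int (int m ^ 2)) z"]) auto
  qed
qed

end

text \<open>The order of an element divides the order of the group; passing to the square-free part
  \<open>D\<close> does not change the field.\<close>

lemma dvd_class_number:
  fixes m t :: nat
  assumes m: "odd m" "m > 1" and t: "odd t"
  shows "t dvd class_number (rat_adjoin_sqrt (1 - 2 * int m ^ t))"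
proof -
  obtain D s where D: "imaginary_sqrt_3_mod_4 D" "s \<noteq> 0" "D * s ^ 2 = 1 - 2 * int m ^ t"
    using squarefree_kernel[OF m odd_pos[OF t]] by blast
  interpret imaginary_sqrt_3_mod_4 D by fact
  interpret C: group "ideal_class_group K" by (rule group_ideal_class_group)
  obtain z where "\<P> #>\<^bsub>\<G>\<^esub> gen (of_int (int m ^ 2)) z \<in> carrier (ideal_class_group K)"
    and "C.ord (\<P> #>\<^bsub>\<G>\<^esub> gen (of_int (int m ^ 2)) z) = t"
    using exists_ideal_class_of_order[OF m t D(3)] by blast
  then have "t dvd class_number K" unfolding class_number_def using C.ord_dvd_group_order by metis
  moreover have "rat_adjoin_sqrt (1 - 2 * int m ^ t) = K"
    unfolding D(3)[symmetric] rat_adjoin_sqrt_mult_square[OF neg D(2)] by (rule rat_adjoin_sqrt_eq)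
  ultimately show ?thesis by simp
qed

text \<open>A single exponent yielding the field \<open>L\<close> determines a square-free
  \<open>D\<close> for it; every other exponent then gives \<open>D\<close> times a square, and
  \<open>finite_exponents\<close> applies.\<close>

lemma finite_exponents_of_field:
  fixes m :: nat
  assumes m: "odd m" "m > 1"
  shows "finite {t. odd t \<and> rat_adjoin_sqrt (1 - 2 * int m ^ t) = L}" (is "finite ?A")
proof (cases "?A = {}")
  case False
  then obtain t where t: "odd t" "rat_adjoin_sqrt (1 - 2 * int m ^ t) = L" by blast
  obtain D s where D: "imaginary_sqrt_3_mod_4 D" "s \<noteq> 0" "D * s ^ 2 = 1 - 2 * int m ^ t"
    using squarefree_kernel[OF m odd_pos[OF t(1)]] by blast
  interpret imaginary_sqrt_3_mod_4 D by fact
  have L: "L = rat_adjoin_sqrt D"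
    unfolding t(2)[symmetric] D(3)[symmetric] by (rule rat_adjoin_sqrt_mult_square[OF neg D(2)])
  have "?A \<subseteq> {t. odd t \<and> (\<exists>s. D * s ^ 2 = 1 - 2 * int m ^ t)}"
  proof clarify
    fix u assume u: "odd u" "L = rat_adjoin_sqrt (1 - 2 * int m ^ u)"
    have "int m ^ u > 0" using m by simp
    then have "1 - 2 * int m ^ u < 0" by linarith
    then show "\<exists>s. D * s ^ 2 = 1 - 2 * int m ^ u"
      using square_multiple_if_rat_adjoin_sqrt_eq[of "1 - 2 * int m ^ u"] u(2) L by metis
  qed
  then show ?thesis using finite_exponents[OF m] by (rule finite_subset)
next
  case True
  then show ?thesis by (metis finite.emptyI)
qed

theorem theorem4:
  fixes t :: nat
  assumes "t > 0" and "odd t" and "squarefree t"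
  shows "(\<forall>q r :: nat. Factorial_Ring.prime q \<and> odd q \<and> r \<ge> 1 \<longrightarrow>
            t dvd class_number (rat_adjoin_sqrt (1 - 2 * int (q ^ r) ^ t))) \<and>
         (\<forall>q r :: nat. Factorial_Ring.prime q \<and> odd q \<and> r \<ge> 1 \<longrightarrow>
            imaginary_quadratic_field (rat_adjoin_sqrt (1 - 2 * int (q ^ r) ^ t))) \<and>
         infinite {rat_adjoin_sqrt (1 - 2 * int (q ^ r) ^ t) | q r :: nat.
                     Factorial_Ring.prime q \<and> odd q \<and> r \<ge> 1}"
proof (intro conjI allI impI)
  fix q r :: nat
  assume "Factorial_Ring.prime q \<and> odd q \<and> r \<ge> 1"
  then have "q > 1" "r > 0" "odd q" using prime_gt_1_nat[of q] by simp_all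
  then have m: "odd (q ^ r)" "q ^ r > 1" using one_less_power[of q r] by simp_all
  show "t dvd class_number (rat_adjoin_sqrt (1 - 2 * int (q ^ r) ^ t))"
    using m assms(2) by (rule dvd_class_number)
  have "int (q ^ r) ^ t > 0" using m(2) by (intro zero_less_power) linarith
  then have "1 - 2 * int (q ^ r) ^ t < 0" by linarith
  then show "imaginary_quadratic_field (rat_adjoin_sqrt (1 - 2 * int (q ^ r) ^ t))"
    by (intro imaginary_sqrt.imaginary_quadratic imaginary_sqrt.intro)
next
  let ?F = "{rat_adjoin_sqrt (1 - 2 * int (q ^ r) ^ t) | q r :: nat.
               Factorial_Ring.prime q \<and> odd q \<and> r \<ge> 1}"
  \<comment> \<open>Fixing the prime 3 keeps the base constant, so that only the exponent
    \<open>r * t\<close> varies; \<open>r\<close> is taken odd to make this exponent odd.\<close>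
  let ?f = "\<lambda>r :: nat. rat_adjoin_sqrt (1 - 2 * int (3 ^ r) ^ t)"
  show "infinite ?F"
  proof
    assume fin: "finite ?F"
    have "?f ` {r. odd r} \<subseteq> ?F"
    proof clarify
      fix r :: nat assume "odd r"
      then have "r \<ge> 1" using odd_pos[of r] by simp
      moreover have "Factorial_Ring.prime (3 :: nat)" "odd (3 :: nat)" by simp_all
      ultimately show "\<exists>q r'. ?f r = rat_adjoin_sqrt (1 - 2 * int (q ^ r') ^ t) \<and>
          Factorial_Ring.prime q \<and> odd q \<and> r' \<ge> 1" by blast
    qed
    then have "finite (?f ` {r. odd r})" using fin by (rule finite_subset)
    moreover have "infinite {r :: nat. odd r}"
    proof
      assume f: "finite {r :: nat. odd r}"
      have "range (\<lambda>n :: nat. 2 * n + 1) \<subseteq> {r. odd r}" by auto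
      then have "finite (range (\<lambda>n :: nat. 2 * n + 1))" using f by (rule finite_subset)
      then show False by (auto dest!: finite_imageD simp: inj_on_def)
    qed
    \<comment> \<open>By the pigeonhole principle one field occurs for infinitely many odd
      \<open>r\<close>. As \<open>t > 0\<close>, the exponents \<open>r * t\<close> are distinct,
      against \<open>finite_exponents_of_field\<close>.\<close>
    ultimately obtain r0 where inf: "infinite {r \<in> {r. odd r}. ?f r = ?f r0}"
      using pigeonhole_infinite[of "{r. odd r}" ?f] by blast
    have "finite {u. odd u \<and> rat_adjoin_sqrt (1 - 2 * int 3 ^ u) = ?f r0}"
      by (rule finite_exponents_of_field) simp_all
    moreover have "(\<lambda>r. r * t) ` {r \<in> {r. odd r}. ?f r = ?f r0}
        \<subseteq> {u. odd u \<and> rat_adjoin_sqrt (1 - 2 * int 3 ^ u) = ?f r0}"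
    proof clarify
      fix r :: nat assume r: "odd r" "?f r = ?f r0"
      have "int 3 ^ (r * t) = int (3 ^ r) ^ t" by (simp add: power_mult)
      then show "odd (r * t) \<and> rat_adjoin_sqrt (1 - 2 * int 3 ^ (r * t)) = ?f r0"
        using r assms(2) by (simp only: even_mult_iff) simp
    qed
    ultimately have "finite ((\<lambda>r. r * t) ` {r \<in> {r. odd r}. ?f r = ?f r0})" by (rule finite_subset[rotated])
    then have "finite {r \<in> {r. odd r}. ?f r = ?f r0}"
      by (rule finite_imageD) (use assms(1) in \<open>auto simp: inj_on_def\<close>)
    then show False using inf by blast
  qed
qed

end
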